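(* Let $m,n,p\ge1$ be integers, let $A\in\mathbb{C}^{m\times n}$, $\tilde n=\operatorname{rank}(A)$, and let $\mathcal{B}_A=\{B_1A,\ldots,B_pA\}$ where each $B_j\in\mathbb{C}^{n\times m}$. Let $u\sim N(0,1)^n$ have i.i.d. real standard normal entries, and let $L\in\mathbb{C}^{n\times p}$ be the matrix whose $j$-th column is $B_jAu$. Let $M=L^*L$, $N=\mathbb{E}M$, $\kappa=\kappa(\mathcal{B}_A)$ and $\lambda=(\tilde n/n)^{1/2}\lambda(\mathcal{B}_A)$. Let $C_1=\sqrt2$ and $C_2=2^{14}$. Suppose that $$\tilde n\ge p\,(C\kappa\lambda\log\tilde n)^2\quad\text{for some } C\ge1 .$$ Then for every $t>0$, $$\mathbb{P}\left(\|M-N\|\ge\frac{t\|N\|}{\kappa}\right)\le (2C_2p)\,\tilde n^{\,1-\alpha},\qquad \alpha=\frac{tC}{eC_1}.$$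
   Context: $\|\cdot\|$ is the spectral norm and $\|\cdot\|_F$ the Frobenius norm; $\langle X,Y\rangle=\operatorname{tr}(X^*Y)$ is the Frobenius inner product. For a finite set of matrices $\mathcal{B}=\{X_1,\dots,X_p\}$ of the same size, $\kappa(\mathcal{B})$ is the (spectral) condition number of the $p\times p$ Gram matrix with entries $\langle X_j,X_k\rangle$ (infinite if this matrix is singular). For a nonzero matrix $X$ with $n$ columns, the weak condition number is $\lambda(X)=\|X\|\,n^{1/2}/\|X\|_F$, and $\lambda(\mathcal{B})=\max_{X\in\mathcal{B}}\lambda(X)$. $\log$ is the natural logarithm and $e$ its base. *)

theory Defs
  imports "HOL-Probability.Probability"
begin

definition conj_transpose :: "complex^'n^'m \<Rightarrow> complex^'m^'n" where
  "conj_transpose X = (\<chi> i j. cnj (X $ j $ i))"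

definition frobenius_inner :: "complex^'n^'m \<Rightarrow> complex^'n^'m \<Rightarrow> complex" where
  "frobenius_inner X Y = trace (conj_transpose X ** Y)"

definition frobenius_norm :: "complex^'n^'m \<Rightarrow> real" where
  "frobenius_norm X = sqrt (\<Sum>i\<in>UNIV. \<Sum>j\<in>UNIV. (cmod (X $ i $ j))\<^sup>2)"

definition spectral_norm :: "complex^'n^'m \<Rightarrow> real" where
  "spectral_norm X = onorm ((*v) X)"

definition condition_number :: "complex^'p^'p \<Rightarrow> ereal" where
  "condition_number G =
     (if invertible G then ereal (spectral_norm G * spectral_norm (matrix_inv G)) else \<infinity>)"

text \<open>A finite set \<open>{X_1, ..., X_p}\<close> of matrices is a family indexed by the finite type \<open>'p\<close>;
  a repeated matrix makes the Gram matrix singular.\<close>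

definition gram_matrix :: "('p::finite \<Rightarrow> complex^'n^'m) \<Rightarrow> complex^'p^'p" where
  "gram_matrix X = (\<chi> j k. frobenius_inner (X j) (X k))"

definition family_condition :: "('p::finite \<Rightarrow> complex^'n^'m) \<Rightarrow> ereal" where
  "family_condition X = condition_number (gram_matrix X)"

text \<open>The weak condition number is only meaningful for \<open>X \<noteq> 0\<close>.\<close>

definition weak_condition :: "complex^'n^'m \<Rightarrow> real" where
  "weak_condition X = spectral_norm X * sqrt (real CARD('n)) / frobenius_norm X"

definition family_weak_condition :: "('p::finite \<Rightarrow> complex^'n^'m) \<Rightarrow> real" where
  "family_weak_condition X = Max (range (\<lambda>j. weak_condition (X j)))"

definition complex_vec :: "real^'n \<Rightarrow> complex^'n" where
  "complex_vec v = (\<chi> i. complex_of_real (v $ i))"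

text \<open>The matrix whose \<open>j\<close>-th column is \<open>X_j v\<close>.\<close>

definition column_matrix :: "('p::finite \<Rightarrow> complex^'n^'m) \<Rightarrow> real^'n \<Rightarrow> complex^'p^'m" where
  "column_matrix X v = (\<chi> i j. (X j *v complex_vec v) $ i)"

definition std_gaussian_vector :: "'w measure \<Rightarrow> ('w \<Rightarrow> real^'n) \<Rightarrow> bool" where
  "std_gaussian_vector P u \<longleftrightarrow>
     prob_space.indep_vars P (\<lambda>_. borel) (\<lambda>i \<omega>. u \<omega> $ i) UNIV \<and>
     (\<forall>i. distributed P lborel (\<lambda>\<omega>. u \<omega> $ i) std_normal_density)"

lemma frobenius_norm_eq_norm: "frobenius_norm X = norm X"
  unfolding frobenius_norm_def norm_vec_def L2_set_def
  by (simp add: sum_nonneg)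

lemma frobenius_inner_self: "frobenius_inner X X = complex_of_real ((frobenius_norm X)\<^sup>2)"
proof -
  have "frobenius_inner X X = (\<Sum>i\<in>UNIV. \<Sum>j\<in>UNIV. cnj (X $ j $ i) * X $ j $ i)"
    by (simp add: frobenius_inner_def trace_def conj_transpose_def matrix_matrix_mult_def)
  also have "\<dots> = (\<Sum>j\<in>UNIV. \<Sum>i\<in>UNIV. complex_of_real ((cmod (X $ j $ i))\<^sup>2))"
    by (subst sum.swap) (simp add: complex_norm_square mult.commute del: of_real_power)
  also have "\<dots> = complex_of_real ((frobenius_norm X)\<^sup>2)"
    by (simp add: frobenius_norm_def sum_nonneg)
  finally show ?thesis .
qed

end

theory Submission
  imports Defs
begin

text \<open>Writing \<open>u = \<Sum>u\<^sub>k e\<^sub>k\<close>, the deviation \<open>Z = M - N\<close> is a Hermitian Gaussian chaos of order two.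
  Integration by parts in \<open>E tr Z\<^sup>2\<^sup>q\<close> and the inequality \<open>tr (G Z\<^sup>a G Z\<^sup>b) \<le> tr (G\<^sup>2 Z\<^sup>a\<^sup>+\<^sup>b)\<close> (for even
  \<open>a + b\<close>) give \<open>E tr Z\<^sup>2\<^sup>q \<le> (2q - 1)/2 \<cdot> E tr (\<Sum>G\<^sub>k\<^sup>2 Z\<^sup>2\<^sup>q\<^sup>-\<^sup>2)\<close>, where \<open>G\<^sub>k\<close> is the \<open>k\<close>-th partial
  derivative of \<open>Z\<close>. By a trace form of Young's inequality it remains to bound
  \<open>E tr (\<Sum>G\<^sub>k\<^sup>2)\<^sup>q\<close>. The \<open>G\<^sub>k\<close> are linear in \<open>u\<close>, so the same recursion applies to the Hermitian
  dilation of their stack. With \<open>\<sigma>\<^sup>2 = p lam\<^sup>2 / r\<close> this yields \<open>E tr Z\<^sup>2\<^sup>q \<le> 4p (2 \<surd>2 q \<sigma> \<parallel>N\<parallel>)\<^sup>2\<^sup>q\<close>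
  when \<open>\<sigma>\<^sup>2 \<le> 3\<close>, and Markov's inequality with the optimal \<open>q\<close> gives the tail bound.

  All matrix inequalities are Cauchy-Schwarz for the Frobenius inner product combined with
  discrete convexity in the exponents, so the spectral theorem is not needed.\<close>

section \<open>Hermitian matrices and the Frobenius inner product\<close>

lemma bounded_bilinear_matrix_mult:
  "bounded_bilinear ((**) :: complex^'b^'a \<Rightarrow> complex^'c^'b \<Rightarrow> complex^'c^'a)"
proof -
  have "bilinear ((**) :: complex^'b^'a \<Rightarrow> complex^'c^'b \<Rightarrow> complex^'c^'a)"
    unfolding bilinear_def
    by (auto intro!: linearI simp: vec_eq_iff matrix_matrix_mult_def algebra_simps sum.distrib
        scaleR_sum_right)
  then show ?thesis
    by (simp add: bilinear_conv_bounded_bilinear)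
qed

lemmas matrix_mult_add_left = bounded_bilinear.add_left [OF bounded_bilinear_matrix_mult]
  and matrix_mult_scaleR_left = bounded_bilinear.scaleR_left [OF bounded_bilinear_matrix_mult]
  and matrix_mult_scaleR_right = bounded_bilinear.scaleR_right [OF bounded_bilinear_matrix_mult]
  and matrix_mult_minus_right = bounded_bilinear.minus_right [OF bounded_bilinear_matrix_mult]
  and matrix_mult_zero_right = bounded_bilinear.zero_right [OF bounded_bilinear_matrix_mult]
  and matrix_mult_sum_right = bounded_bilinear.sum_right [OF bounded_bilinear_matrix_mult]

lemma bounded_linear_conj_transpose:
  "bounded_linear (conj_transpose :: complex^'b^'a \<Rightarrow> complex^'a^'b)"
  by (auto intro!: linear_conv_bounded_linear [THEN iffD1] linearI
      simp: vec_eq_iff conj_transpose_def)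

lemma conj_transpose_nth [simp]: "conj_transpose X $ i $ j = cnj (X $ j $ i)"
  by (simp add: conj_transpose_def)

lemma conj_transpose_conj_transpose [simp]: "conj_transpose (conj_transpose X) = X"
  by (simp add: vec_eq_iff)

lemma conj_transpose_mult: "conj_transpose (A ** B) = conj_transpose B ** conj_transpose A"
  by (simp add: vec_eq_iff matrix_matrix_mult_def mult.commute)

lemma conj_transpose_mat_1 [simp]: "conj_transpose (mat 1) = (mat 1 :: complex^'a^'a)"
  by (simp add: vec_eq_iff mat_def)

lemma inner_mult_complex: "(a * x) \<bullet> y = x \<bullet> (cnj a * y)" for a x y :: complex
  by (simp add: inner_complex_def algebra_simps)

text \<open>The inner product of the type is the real part of the Frobenius inner product, so a left
  factor crosses it as its conjugate transpose.\<close>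

lemma inner_matrix_mult_left:
  fixes A :: "complex^'b^'a"
  shows "(A ** X) \<bullet> Y = X \<bullet> (conj_transpose A ** Y)"
proof -
  have "(A ** X) \<bullet> Y = (\<Sum>i\<in>UNIV. \<Sum>j\<in>UNIV. \<Sum>k\<in>UNIV. X $ k $ j \<bullet> (cnj (A $ i $ k) * Y $ i $ j))"
    by (simp add: inner_vec_def matrix_matrix_mult_def inner_sum_left inner_mult_complex)
  also have "\<dots> = (\<Sum>i\<in>UNIV. \<Sum>k\<in>UNIV. \<Sum>j\<in>UNIV. X $ k $ j \<bullet> (cnj (A $ i $ k) * Y $ i $ j))"
    by (intro sum.cong sum.swap refl)
  also have "\<dots> = (\<Sum>k\<in>UNIV. \<Sum>i\<in>UNIV. \<Sum>j\<in>UNIV. X $ k $ j \<bullet> (cnj (A $ i $ k) * Y $ i $ j))"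
    by (rule sum.swap)
  also have "\<dots> = (\<Sum>k\<in>UNIV. \<Sum>j\<in>UNIV. \<Sum>i\<in>UNIV. X $ k $ j \<bullet> (cnj (A $ i $ k) * Y $ i $ j))"
    by (intro sum.cong sum.swap refl)
  also have "\<dots> = X \<bullet> (conj_transpose A ** Y)"
    by (simp add: inner_vec_def matrix_matrix_mult_def inner_sum_right)
  finally show ?thesis .
qed

lemma inner_conj_transpose: "conj_transpose X \<bullet> conj_transpose Y = X \<bullet> Y"
proof -
  have "conj_transpose X \<bullet> conj_transpose Y = (\<Sum>i\<in>UNIV. \<Sum>j\<in>UNIV. X $ j $ i \<bullet> Y $ j $ i)"
    by (simp add: inner_vec_def inner_complex_def)
  also have "\<dots> = X \<bullet> Y"
    unfolding inner_vec_def by (rule sum.swap)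
  finally show ?thesis .
qed

lemma norm_conj_transpose [simp]: "norm (conj_transpose X) = norm X"
  by (simp add: norm_eq_sqrt_inner inner_conj_transpose)

lemma inner_matrix_mult_right:
  fixes A :: "complex^'c^'b"
  shows "(X ** A) \<bullet> Y = X \<bullet> (Y ** conj_transpose A)"
proof -
  have "(X ** A) \<bullet> Y = (conj_transpose A ** conj_transpose X) \<bullet> conj_transpose Y"
    by (metis inner_conj_transpose conj_transpose_mult)
  also have "\<dots> = conj_transpose X \<bullet> (A ** conj_transpose Y)"
    by (simp add: inner_matrix_mult_left)
  also have "\<dots> = X \<bullet> (Y ** conj_transpose A)"
    by (metis conj_transpose_conj_transpose conj_transpose_mult inner_conj_transpose)
  finally show ?thesis .
qed

section \<open>Matrix powers and Hermitian matrices\<close>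

primrec mpow :: "complex^'a^'a \<Rightarrow> nat \<Rightarrow> complex^'a^'a" where
  "mpow A 0 = mat 1"
| "mpow A (Suc n) = A ** mpow A n"

lemma mpow_add: "mpow A (m + n) = mpow A m ** mpow A n"
  by (induction m) (simp_all add: matrix_mul_assoc)

lemma mpow_commute: "mpow A n ** A = A ** mpow A n"
  by (induction n) (simp_all flip: matrix_mul_assoc)

lemma mpow_Suc_right: "mpow A (Suc n) = mpow A n ** A"
  by (simp add: mpow_commute)

lemma mpow_scaleR: "mpow (c *\<^sub>R A) n = c ^ n *\<^sub>R mpow A n"
  by (induction n) (simp_all add: matrix_mult_scaleR_left matrix_mult_scaleR_right)

definition hermitian :: "complex^'a^'a \<Rightarrow> bool" where
  "hermitian A \<longleftrightarrow> conj_transpose A = A"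

lemma hermitian_mpow: "hermitian A \<Longrightarrow> hermitian (mpow A n)"
  unfolding hermitian_def by (induction n) (simp_all add: conj_transpose_mult mpow_commute)

lemma hermitian_inner_left: "hermitian A \<Longrightarrow> (A ** X) \<bullet> Y = X \<bullet> (A ** Y)"
  by (simp add: hermitian_def inner_matrix_mult_left)

lemma hermitian_inner_right: "hermitian A \<Longrightarrow> (X ** A) \<bullet> Y = X \<bullet> (Y ** A)"
  by (simp add: hermitian_def inner_matrix_mult_right)

section \<open>Trace inequalities from discrete convexity in the exponents\<close>

lemma inner_le_half_norms:
  fixes x y :: "'a::real_inner"
  shows "x \<bullet> y \<le> ((norm x)\<^sup>2 + (norm y)\<^sup>2) / 2"
proof -
  have "0 \<le> (x - y) \<bullet> (x - y)" by simp
  then show ?thesis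
    by (simp add: inner_diff_left inner_diff_right power2_norm_eq_inner inner_commute)
qed

text \<open>A convex sequence lies below its chord. This turns the midpoint inequalities supplied by
  Cauchy-Schwarz into bounds by the endpoint values.\<close>

lemma discrete_convex_bound:
  fixes f :: "nat \<Rightarrow> real"
  assumes conv: "\<And>j. 0 < j \<Longrightarrow> j < c \<Longrightarrow> 2 * f j \<le> f (j - 1) + f (j + 1)"
    and "j \<le> c"
  shows "real c * f j \<le> real (c - j) * f 0 + real j * f c"
proof -
  define d where "d i = f (Suc i) - f i" for i
  have mono: "d i \<le> d k" if "i \<le> k" "k < c" for i k
    using that
  proof (induction k rule: dec_induct)
    case (step k)
    have "d k \<le> d (Suc k)"
      using conv [of "Suc k"] step.prems by (simp add: d_def)
    with step show ?case by simp
  qed simp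
  have *: "(\<Sum>i=a..<b. d i) = f b - f a" if "a \<le> b" for a b
    unfolding d_def using that by (rule sum_Suc_diff')
  \<comment> \<open>The increments increase: the first \<open>j\<close> are at most
    \<open>d (j - 1)\<close>, those from \<open>j\<close> on at least \<open>d j\<close>. Comparing
    the two averages gives the chord bound.\<close>
  have lo: "f j - f 0 \<le> real j * d (j - 1)" if "0 < j"
  proof -
    have "(\<Sum>i=0..<j. d i) \<le> (\<Sum>i=0..<j. d (j - 1))"
      using that \<open>j \<le> c\<close> by (intro sum_mono mono) auto
    then show ?thesis by (simp add: *)
  qed
  have hi: "real (c - j) * d j \<le> f c - f j" if "j < c"
  proof -
    have "(\<Sum>i=j..<c. d j) \<le> (\<Sum>i=j..<c. d i)"
      using that by (intro sum_mono mono) auto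
    then show ?thesis using that by (simp add: *)
  qed
  show ?thesis
  proof (cases "0 < j \<and> j < c")
    case True
    have "real (c - j) * (f j - f 0) \<le> real (c - j) * (real j * d (j - 1))"
      using lo True by (intro mult_left_mono) auto
    also have "\<dots> \<le> real (c - j) * (real j * d j)"
      using mono [of "j - 1" j] True by (intro mult_left_mono) auto
    also have "\<dots> = real j * (real (c - j) * d j)" by simp
    also have "\<dots> \<le> real j * (f c - f j)"
      using hi True by (intro mult_left_mono) auto
    finally show ?thesis
      using \<open>j \<le> c\<close> by (simp add: of_nat_diff algebra_simps)
  next
    case False
    then have "j = 0 \<or> j = c" using \<open>j \<le> c\<close> by auto
    then show ?thesis by auto
  qed
qed

text \<open>In the squared norm, one \<open>D\<close> moves from the left end of the first copy to
  the second, and one \<open>Z\<close> from the right end of the second copy to the first. This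
  leaves the inner product of the two neighbouring terms.\<close>

lemma norm_pow_prod_convex:
  assumes "hermitian D" "hermitian Z" "0 < j" "j < q"
  shows "2 * (norm (mpow D j ** mpow Z (q - j)))\<^sup>2
    \<le> (norm (mpow D (j - 1) ** mpow Z (q - (j - 1))))\<^sup>2 + (norm (mpow D (j + 1) ** mpow Z (q - (j + 1))))\<^sup>2"
proof -
  obtain i where j: "j = Suc i" using \<open>0 < j\<close> by (cases j) auto
  obtain k where q: "q = Suc (Suc i) + k" using \<open>j < q\<close> j by (metis less_iff_Suc_add add_Suc)
  have e1: "mpow D (Suc i) ** mpow Z (Suc k) = D ** (mpow D i ** mpow Z (Suc k))"
    by (simp add: matrix_mul_assoc)
  have e2: "D ** (mpow D (Suc i) ** mpow Z (Suc k)) = (mpow D (Suc (Suc i)) ** mpow Z k) ** Z"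
    by (simp only: mpow_Suc_right [of Z] mpow.simps(2) [of D] matrix_mul_assoc)
  have e3: "(mpow D i ** mpow Z (Suc k)) ** Z = mpow D i ** mpow Z (Suc (Suc k))"
    by (simp only: mpow_Suc_right [of Z] matrix_mul_assoc)
  have "(norm (mpow D j ** mpow Z (q - j)))\<^sup>2 = (mpow D (Suc i) ** mpow Z (Suc k)) \<bullet> (mpow D (Suc i) ** mpow Z (Suc k))"
    by (simp add: j q power2_norm_eq_inner del: mpow.simps)
  also have "\<dots> = (mpow D i ** mpow Z (Suc k)) \<bullet> (D ** (mpow D (Suc i) ** mpow Z (Suc k)))"
    using hermitian_inner_left [OF assms(1)] e1 by metis
  also have "\<dots> = (mpow D i ** mpow Z (Suc (Suc k))) \<bullet> (mpow D (Suc (Suc i)) ** mpow Z k)"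
    using hermitian_inner_right [OF assms(2)] e2 e3 by metis
  also have "\<dots> \<le> ((norm (mpow D i ** mpow Z (Suc (Suc k))))\<^sup>2 + (norm (mpow D (Suc (Suc i)) ** mpow Z k))\<^sup>2) / 2"
    by (rule inner_le_half_norms)
  finally show ?thesis by (simp add: j q Suc_diff_le del: mpow.simps)
qed

text \<open>Trace form of Young's inequality for tr (D^2 Z^(2q-2)): the chord bound at
  \<open>j = 1\<close> between the endpoints Z^q and D^q.\<close>

lemma hermitian_Young:
  assumes "hermitian D" "hermitian Z" "0 < q"
  shows "real q * (norm (D ** mpow Z (q - 1)))\<^sup>2 \<le> real (q - 1) * (norm (mpow Z q))\<^sup>2 + (norm (mpow D q))\<^sup>2"
  using discrete_convex_bound [of q "\<lambda>j. (norm (mpow D j ** mpow Z (q - j)))\<^sup>2" 1]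
    norm_pow_prod_convex [OF assms(1,2)] assms(3) by simp

lemma hermitian_Young_scaled:
  assumes "hermitian D" "hermitian Z" "0 < q" "0 < c"
  shows "real q * (c * (norm (D ** mpow Z (q - 1)))\<^sup>2) \<le> real (q - 1) * (norm (mpow Z q))\<^sup>2 + c ^ q * (norm (mpow D q))\<^sup>2"
proof -
  have h: "hermitian (sqrt c *\<^sub>R D)"
    using assms(1) by (simp add: hermitian_def linear_cmul [OF bounded_linear.linear, OF bounded_linear_conj_transpose])
  have "(sqrt c)\<^sup>2 = c" "(sqrt c ^ q)\<^sup>2 = c ^ q"
    using \<open>0 < c\<close> by (simp_all flip: power_mult power_mult_distrib add: power2_eq_square)
  then show ?thesis
    using hermitian_Young [OF h assms(2,3)] \<open>0 < c\<close>
    by (simp add: matrix_mult_scaleR_left mpow_scaleR power_mult_distrib)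
qed

text \<open>Moving a \<open>Z\<close> across at the left end in one direction and at the right end
  in the other shifts the exponents of the two copies oppositely.\<close>

lemma norm_sandwich_convex:
  assumes "hermitian Z" "0 < j" "j < c"
  shows "2 * (norm (mpow Z (c - j) ** H ** mpow Z j))\<^sup>2
    \<le> (norm (mpow Z (c - (j - 1)) ** H ** mpow Z (j - 1)))\<^sup>2 + (norm (mpow Z (c - (j + 1)) ** H ** mpow Z (j + 1)))\<^sup>2"
proof -
  obtain i where j: "j = Suc i" using \<open>0 < j\<close> by (cases j) auto
  obtain k where c: "c = Suc (Suc i) + k" using \<open>j < c\<close> j by (metis less_iff_Suc_add add_Suc)
  have e1: "mpow Z (Suc k) ** H ** mpow Z (Suc i) = Z ** (mpow Z k ** H ** mpow Z (Suc i))"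
    by (simp add: matrix_mul_assoc)
  have e2: "Z ** (mpow Z (Suc k) ** H ** mpow Z (Suc i)) = (mpow Z (Suc (Suc k)) ** H ** mpow Z i) ** Z"
    by (simp only: mpow_Suc_right [of Z i] mpow.simps(2) [of Z "Suc k"] matrix_mul_assoc)
  have e3: "(mpow Z k ** H ** mpow Z (Suc i)) ** Z = mpow Z k ** H ** mpow Z (Suc (Suc i))"
    by (simp only: mpow_Suc_right [of Z "Suc i"] matrix_mul_assoc)
  have "(norm (mpow Z (c - j) ** H ** mpow Z j))\<^sup>2 = (mpow Z (Suc k) ** H ** mpow Z (Suc i)) \<bullet> (mpow Z (Suc k) ** H ** mpow Z (Suc i))"
    by (simp add: j c power2_norm_eq_inner del: mpow.simps)
  also have "\<dots> = (mpow Z k ** H ** mpow Z (Suc i)) \<bullet> (Z ** (mpow Z (Suc k) ** H ** mpow Z (Suc i)))"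
    using hermitian_inner_left [OF assms(1)] e1 by metis
  also have "\<dots> = (mpow Z k ** H ** mpow Z (Suc (Suc i))) \<bullet> (mpow Z (Suc (Suc k)) ** H ** mpow Z i)"
    using hermitian_inner_right [OF assms(1)] e2 e3 by metis
  also have "\<dots> \<le> ((norm (mpow Z k ** H ** mpow Z (Suc (Suc i))))\<^sup>2 + (norm (mpow Z (Suc (Suc k)) ** H ** mpow Z i))\<^sup>2) / 2"
    by (rule inner_le_half_norms)
  finally show ?thesis by (simp add: j c Suc_diff_le del: mpow.simps)
qed

text \<open>The endpoints of the chord, Z^c H and H Z^c, are conjugate transposes of each other and
  so have equal norm.\<close>

lemma norm_sandwich_le:
  assumes "hermitian Z" "hermitian H" "j \<le> c"
  shows "(norm (mpow Z (c - j) ** H ** mpow Z j))\<^sup>2 \<le> (norm (H ** mpow Z c))\<^sup>2"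
proof (cases "c = 0")
  case False
  let ?f = "\<lambda>j. (norm (mpow Z (c - j) ** H ** mpow Z j))\<^sup>2"
  have "conj_transpose (mpow Z c ** H) = H ** mpow Z c"
    using hermitian_mpow [OF assms(1)] assms(2) by (simp add: conj_transpose_mult hermitian_def)
  then have eq: "?f 0 = (norm (H ** mpow Z c))\<^sup>2"
    by simp (metis norm_conj_transpose)
  have "real c * ?f j \<le> real (c - j) * ?f 0 + real j * ?f c"
    using norm_sandwich_convex [OF assms(1)] by (intro discrete_convex_bound assms(3)) auto
  also have "\<dots> = real c * (norm (H ** mpow Z c))\<^sup>2"
    unfolding eq using \<open>j \<le> c\<close> by (simp add: of_nat_diff algebra_simps)
  finally show ?thesis using False by simp
qed (use assms in simp)

text \<open>This is tr (H Z^a H Z^b) \<le> tr (H^2 Z^(a+b)). The powers of \<open>Z\<close> are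
  shared between the two factors \<open>H\<close> so that each receives \<open>c\<close> of
  them.\<close>

lemma inner_sandwich_le:
  assumes Z: "hermitian Z" and H: "hermitian H" and "a + b = 2 * c"
  shows "H \<bullet> (mpow Z a ** H ** mpow Z b) \<le> (norm (H ** mpow Z c))\<^sup>2"
proof -
  have split: "H \<bullet> (mpow Z (i + j) ** H ** mpow Z (k + l)) = (mpow Z i ** H ** mpow Z k) \<bullet> (mpow Z j ** H ** mpow Z l)"
    for i j k l
  proof -
    have "H \<bullet> (mpow Z (i + j) ** H ** mpow Z (k + l)) = H \<bullet> (mpow Z i ** ((mpow Z j ** H ** mpow Z l) ** mpow Z k))"
      by (simp add: mpow_add matrix_mul_assoc add.commute [of k l])
    also have "\<dots> = (mpow Z i ** H) \<bullet> ((mpow Z j ** H ** mpow Z l) ** mpow Z k)"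
      using hermitian_inner_left [OF hermitian_mpow [OF Z]] by metis
    also have "\<dots> = (mpow Z i ** H ** mpow Z k) \<bullet> (mpow Z j ** H ** mpow Z l)"
      using hermitian_inner_right [OF hermitian_mpow [OF Z]] by metis
    finally show ?thesis .
  qed
  show ?thesis
  proof (cases "even a")
    case True
    then obtain i where a: "a = i + i" by (metis evenE mult_2)
    have "i \<le> c" using assms(3) a by linarith
    then obtain k where c: "c = i + k" using le_Suc_ex by blast
    with a assms(3) have b: "b = k + k" by simp
    show ?thesis
      using norm_sandwich_le [OF Z H, of k c] unfolding a b split
      by (simp add: power2_norm_eq_inner c)
  next
    case False
    \<comment> \<open>For odd \<open>a\<close> the exponents split as \<open>Suc i + i\<close> and
      \<open>k + Suc k\<close>, so both resulting matrices still carry \<open>c\<close> factors of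
      \<open>Z\<close>.\<close>
    then obtain i where a: "a = Suc i + i" by (metis oddE mult_2 Suc_eq_plus1 add_Suc)
    have "Suc i \<le> c" using assms(3) a by linarith
    then obtain k where "c = Suc i + k" using le_Suc_ex by blast
    then have c: "c = Suc (i + k)" by simp
    with a assms(3) have b: "b = k + Suc k" by linarith
    have "H \<bullet> (mpow Z a ** H ** mpow Z b)
        \<le> ((norm (mpow Z (Suc i) ** H ** mpow Z k))\<^sup>2 + (norm (mpow Z i ** H ** mpow Z (Suc k)))\<^sup>2) / 2"
      unfolding a b split by (rule inner_le_half_norms)
    also have "\<dots> \<le> (norm (H ** mpow Z c))\<^sup>2"
      using norm_sandwich_le [OF Z H, of k c] norm_sandwich_le [OF Z H, of "Suc k" c]
      unfolding c by (simp add: Suc_diff_le del: mpow.simps power_mono_iff)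
    finally show ?thesis .
  qed
qed

section \<open>Spectral norm against the Frobenius norm of powers\<close>

lemma norm_matrix_vector_mult_le: "norm (A *v x) \<le> norm A * norm x" for A :: "complex^'b^'a"
proof -
  have "cmod ((A *v x) $ i) \<le> norm (A $ i) * norm x" for i
  proof -
    have "cmod ((A *v x) $ i) \<le> (\<Sum>j\<in>UNIV. cmod (A $ i $ j) * cmod (x $ j))"
      unfolding matrix_vector_mult_def
      by (simp add: norm_mult sum_norm_le)
    also have "\<dots> \<le> norm (A $ i) * norm x"
      using L2_set_mult_ineq [of "\<lambda>j. cmod (A $ i $ j)" "\<lambda>j. cmod (x $ j)" UNIV]
      by (simp add: norm_vec_def)
    finally show ?thesis .
  qed
  then have "L2_set (\<lambda>i. cmod ((A *v x) $ i)) UNIV \<le> L2_set (\<lambda>i. norm (A $ i) * norm x) UNIV"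
    by (intro L2_set_mono) auto
  then show ?thesis
    by (simp add: norm_vec_def [of "A *v x"] norm_vec_def [of A] L2_set_left_distrib)
qed

lemma bounded_linear_matrix_vector_mult: "bounded_linear ((*v) (A :: complex^'b^'a))"
proof (rule bounded_linear_intro)
  show "norm (A *v x) \<le> norm x * norm A" for x
    using norm_matrix_vector_mult_le [of A x] by (simp add: mult.commute)
  show "A *v (c *\<^sub>R x) = c *\<^sub>R (A *v x)" for c x
    by (simp add: vec_eq_iff matrix_vector_mult_def scaleR_sum_right)
qed (rule matrix_vector_right_distrib)

lemma norm_matrix_vector_le_spectral: "norm (A *v x) \<le> spectral_norm A * norm x" for A :: "complex^'b^'a"
  unfolding spectral_norm_def by (rule onorm [OF bounded_linear_matrix_vector_mult])

lemma spectral_norm_nonneg: "0 \<le> spectral_norm A" for A :: "complex^'b^'a"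
  unfolding spectral_norm_def by (rule onorm_pos_le [OF bounded_linear_matrix_vector_mult])

lemma inner_matrix_vector: "(A *v x) \<bullet> y = x \<bullet> (conj_transpose A *v y)" for A :: "complex^'b^'a"
proof -
  have "(A *v x) \<bullet> y = (\<Sum>i\<in>UNIV. \<Sum>j\<in>UNIV. x $ j \<bullet> (cnj (A $ i $ j) * y $ i))"
    by (simp add: inner_vec_def matrix_vector_mult_def inner_sum_left inner_mult_complex)
  also have "\<dots> = x \<bullet> (conj_transpose A *v y)"
    by (subst sum.swap) (simp add: inner_vec_def matrix_vector_mult_def inner_sum_right)
  finally show ?thesis .
qed

text \<open>The numbers |Z^j x| are log-convex in j, so their successive ratios increase and (|Zx| /
  |x|)^q \<le> |Z^q x| / |x|. The form without denominators also covers vanishing terms.\<close>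

lemma norm_power_le_mpow:
  assumes Z: "hermitian Z"
  shows "norm (Z *v x) ^ q * norm x \<le> norm x ^ q * norm (mpow Z q *v x)"
proof -
  define a where "a j = norm (mpow Z j *v x)" for j
  have a0: "a 0 = norm x" and a1: "a 1 = norm (Z *v x)" by (simp_all add: a_def)
  have nn: "a j \<ge> 0" for j by (simp add: a_def)
  have conv: "a (Suc j) * a (Suc j) \<le> a j * a (Suc (Suc j))" for j
  proof -
    have "a (Suc j) * a (Suc j) = (Z *v (mpow Z j *v x)) \<bullet> (mpow Z (Suc j) *v x)"
      by (simp add: a_def matrix_vector_mul_assoc flip: power2_norm_eq_inner power2_eq_square)
    also have "\<dots> = (mpow Z j *v x) \<bullet> (Z *v (mpow Z (Suc j) *v x))"
      using Z by (simp only: inner_matrix_vector hermitian_def)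
    also have "\<dots> = (mpow Z j *v x) \<bullet> (mpow Z (Suc (Suc j)) *v x)"
      by (simp add: matrix_vector_mul_assoc)
    also have "\<dots> \<le> a j * a (Suc (Suc j))"
      unfolding a_def by (rule norm_cauchy_schwarz)
    finally show ?thesis .
  qed
  have zero: "a (Suc j) = 0" if "a j = 0" for j
    using that by (simp add: a_def matrix_vector_mul_assoc [symmetric])
  \<comment> \<open>The first ratio is compared with the \<open>j\<close>-th one; once some
    \<open>a j\<close> vanishes, so does its successor.\<close>
  have ratio: "a 1 * a j \<le> a 0 * a (Suc j)" for j
  proof (induction j)
    case (Suc j)
    show ?case
    proof (cases "a j = 0")
      case True
      then show ?thesis using zero by simp
    next
      case False
      have "a j * (a 1 * a (Suc j)) = (a 1 * a j) * a (Suc j)" by simp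
      also have "\<dots> \<le> a 0 * (a (Suc j) * a (Suc j))"
        using mult_right_mono [OF Suc nn [of "Suc j"]] by (simp add: mult.assoc)
      also have "\<dots> \<le> a 0 * (a j * a (Suc (Suc j)))"
        by (intro mult_left_mono conv nn)
      finally have "a j * (a 1 * a (Suc j)) \<le> a j * (a 0 * a (Suc (Suc j)))"
        by (simp add: mult_ac)
      then show ?thesis
        using False nn [of j] by simp
    qed
  qed (simp add: mult.commute)
  have "a 1 ^ q * a 0 \<le> a 0 ^ q * a q"
  proof (induction q)
    case (Suc q)
    have "a 1 ^ Suc q * a 0 = a 1 * (a 1 ^ q * a 0)" by simp
    also have "\<dots> \<le> a 1 * (a 0 ^ q * a q)"
      by (intro mult_left_mono Suc nn)
    also have "\<dots> = a 0 ^ q * (a 1 * a q)" by simp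
    also have "\<dots> \<le> a 0 ^ q * (a 0 * a (Suc q))"
      by (intro mult_left_mono ratio zero_le_power nn)
    finally show ?case by (simp add: mult_ac)
  qed simp
  then show ?thesis unfolding a0 a1 by (simp add: a_def)
qed

text \<open>Links the spectral norm to trace moments without eigenvalues: the square of the bound
  reads ||Z||^(2q) \<le> tr Z^(2q).\<close>

lemma spectral_norm_power_le:
  assumes Z: "hermitian Z" and "0 < q"
  shows "spectral_norm Z ^ q \<le> norm (mpow Z q)"
proof -
  let ?r = "root q (norm (mpow Z q))"
  have "norm (Z *v x) \<le> ?r * norm x" for x
  proof (cases "x = 0")
    case False
    have "norm (Z *v x) ^ q * norm x \<le> norm x ^ q * (norm (mpow Z q) * norm x)"
      using norm_power_le_mpow [OF Z, of x q]
      by (rule order_trans) (intro mult_left_mono norm_matrix_vector_mult_le; simp)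
    then have "norm (Z *v x) ^ q \<le> norm x ^ q * norm (mpow Z q)"
      using False by simp
    also have "\<dots> = (?r * norm x) ^ q"
      using \<open>0 < q\<close> by (simp add: power_mult_distrib)
    finally show ?thesis
      by (subst (asm) power_mono_iff) (use \<open>0 < q\<close> in auto)
  qed simp
  then have "spectral_norm Z \<le> ?r"
    unfolding spectral_norm_def using \<open>0 < q\<close> by (intro onorm_bound) auto
  then have "spectral_norm Z ^ q \<le> ?r ^ q"
    by (intro power_mono spectral_norm_nonneg)
  then show ?thesis using \<open>0 < q\<close> by simp
qed

section \<open>Gaussian integration by parts\<close>

definition gaussian_moment :: "nat \<Rightarrow> real" where
  "gaussian_moment k = (\<integral>x. std_normal_density x * x ^ k \<partial>lborel)"

text \<open>One-dimensional integration by parts for x^k, read off from the moment formulas. At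
  \<open>k = 0\<close> the factor \<open>k\<close> makes the truncated subtraction harmless.\<close>

lemma gaussian_moment_Suc: "gaussian_moment (Suc k) = real k * gaussian_moment (k - 1)"
proof (cases "even k")
  case True
  then obtain j where k: "k = 2 * j" by (elim evenE)
  have "gaussian_moment (2 * i + 1) = 0" for i
    unfolding gaussian_moment_def by (rule integral_std_normal_moment_odd)
  from this [of j] this [of "j - 1"] show ?thesis
    unfolding k by (cases j) auto
next
  case False
  then obtain j where k: "k = 2 * j + 1" by (elim oddE)
  have "gaussian_moment (2 * i) = fact (2 * i) / (2 ^ i * fact i)" for i
    unfolding gaussian_moment_def by (rule integral_std_normal_moment_even)
  note m = this
  have "fact (2 * Suc j) / (2 ^ Suc j * fact (Suc j)) = real (2 * j + 1) * (fact (2 * j) / (2 ^ j * fact j))"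
    by (simp add: divide_simps)
  then show ?thesis
    unfolding k using m [of "Suc j"] m [of j] by simp
qed

section \<open>Monomials and polynomial functions\<close>

definition monomial :: "('n::finite \<Rightarrow> nat) \<Rightarrow> real^'n \<Rightarrow> real" where
  "monomial a x = (\<Prod>i\<in>UNIV. x $ i ^ a i)"

lemma monomial_add: "monomial a x * monomial b x = monomial (\<lambda>i. a i + b i) x"
  by (simp add: monomial_def power_add prod.distrib)

lemma monomial_remove: "monomial a x = x $ k ^ a k * (\<Prod>i\<in>UNIV - {k}. x $ i ^ a i)"
  by (simp add: monomial_def prod.remove)

text \<open>Linear combinations of monomials built one term at a time, so that claims linear in the
  polynomial follow by induction from monomials.\<close>

inductive monomial_span :: "(real^'n \<Rightarrow> real) \<Rightarrow> bool" where
  zero: "monomial_span (\<lambda>x. 0)"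
| step: "monomial_span f \<Longrightarrow> monomial_span (\<lambda>x. c * monomial a x + f x)"

lemma monomial_span_add: "monomial_span f \<Longrightarrow> monomial_span g \<Longrightarrow> monomial_span (\<lambda>x. f x + g x)"
  by (induction rule: monomial_span.induct) (simp_all add: add.assoc monomial_span.step)

lemma monomial_span_mult_monomial: "monomial_span f \<Longrightarrow> monomial_span (\<lambda>x. c * monomial a x * f x)"
proof (induction rule: monomial_span.induct)
  case (step f d b)
  have "(\<lambda>x. c * monomial a x * (d * monomial b x + f x)) =
      (\<lambda>x. (c * d) * monomial (\<lambda>i. a i + b i) x + c * monomial a x * f x)"
    by (simp add: algebra_simps flip: monomial_add)
  then show ?case by (simp add: monomial_span.step step)
qed (simp add: monomial_span.zero)

lemma monomial_span_mult: "monomial_span f \<Longrightarrow> monomial_span g \<Longrightarrow> monomial_span (\<lambda>x. f x * g x)"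
proof (induction rule: monomial_span.induct)
  case (step f c a)
  then show ?case
    using monomial_span_add [OF monomial_span_mult_monomial] by (simp add: distrib_right)
qed (simp add: monomial_span.zero)

lemma monomial_span_sum:
  "finite I \<Longrightarrow> (\<And>i. i \<in> I \<Longrightarrow> monomial_span (f i)) \<Longrightarrow> monomial_span (\<lambda>x. \<Sum>i\<in>I. f i x)"
  by (induction rule: finite_induct) (simp_all add: monomial_span.zero monomial_span_add)

lemma monomial_span_real_polynomial:
  fixes f :: "real^'n \<Rightarrow> real"
  shows "real_polynomial_function f \<Longrightarrow> monomial_span f"
proof (induction rule: real_polynomial_function.induct)
  case (linear f)
  \<comment> \<open>A linear functional is a combination of coordinates, and coordinate
    \<open>i\<close> is the monomial whose exponent vector is the indicator of
    \<open>i\<close>.\<close>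
  have "monomial_span (\<lambda>x. f (axis i 1) * monomial (\<lambda>j. of_bool (j = i)) x)" for i :: 'n
    using monomial_span.step [OF monomial_span.zero] by simp
  then have "monomial_span (\<lambda>x. \<Sum>i\<in>UNIV. f (axis i 1) * monomial (\<lambda>j. of_bool (j = i)) x)"
    by (intro monomial_span_sum) auto
  moreover have "(\<Sum>i\<in>UNIV. f (axis i 1) * monomial (\<lambda>j. of_bool (j = i)) x) = f x" for x
  proof -
    have "monomial (\<lambda>j. of_bool (j = i)) x = x $ i" for i
      by (simp add: monomial_remove [of _ _ i])
    moreover have "f x = f (\<Sum>i\<in>UNIV. x $ i *\<^sub>R axis i 1)"
      using basis_expansion [of x] by (simp add: scalar_mult_eq_scaleR)
    then have "f x = (\<Sum>i\<in>UNIV. x $ i * f (axis i 1))"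
      using linear by (simp add: bounded_linear.linear linear_sum linear_cmul)
    ultimately show ?thesis by (simp add: mult.commute)
  qed
  ultimately show ?case by simp
next
  case (const c)
  have "monomial_span (\<lambda>x :: real^'n. c * monomial (\<lambda>_. 0) x + 0)"
    by (intro monomial_span.intros)
  then show ?case by (simp add: monomial_def)
qed (simp_all add: monomial_span_add monomial_span_mult)

lemma monomial_deriv:
  "((\<lambda>t. monomial a (x + t *\<^sub>R axis k 1)) has_vector_derivative
      real (a k) * monomial (a(k := a k - 1)) x) (at 0)"
proof -
  let ?c = "\<Prod>i\<in>UNIV - {k}. x $ i ^ a i"
  have "monomial a (x + t *\<^sub>R axis k 1) = (x $ k + t) ^ a k * ?c" for t
    by (simp add: monomial_remove [of a _ k] axis_def)
  moreover have "((\<lambda>t. (x $ k + t) ^ a k * ?c) has_real_derivative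
      real (a k) * (x $ k + 0) ^ (a k - 1) * ?c) (at 0)"
    by (auto intro!: derivative_eq_intros)
  moreover have "monomial (a(k := a k - 1)) x = x $ k ^ (a k - 1) * ?c"
  proof -
    have "?c = (\<Prod>i\<in>UNIV - {k}. x $ i ^ (a(k := a k - 1)) i)"
      by (intro prod.cong) auto
    then show ?thesis unfolding monomial_remove [of "a(k := a k - 1)" x k] by (simp only: fun_upd_same)
  qed
  ultimately show ?thesis
    by (simp add: has_real_derivative_iff_has_vector_derivative mult.assoc)
qed

section \<open>Moments of a Gaussian vector and integration by parts\<close>

locale gaussian_vector = prob_space P for P :: "'w measure" +
  fixes u :: "'w \<Rightarrow> real^'n"
  assumes gaussian: "std_gaussian_vector P u"
begin

lemma coordinate_moment:
  shows "integrable P (\<lambda>w. (u w $ i) ^ k)" and "expectation (\<lambda>w. (u w $ i) ^ k) = gaussian_moment k"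
proof -
  have D: "distributed P lborel (\<lambda>w. u w $ i) std_normal_density"
    using gaussian by (simp add: std_gaussian_vector_def)
  show "integrable P (\<lambda>w. (u w $ i) ^ k)"
    using distributed_integrable [OF D, of "\<lambda>x. x ^ k"] integrable_std_normal_moment by simp
  show "expectation (\<lambda>w. (u w $ i) ^ k) = gaussian_moment k"
    using distributed_integral [OF D, of "\<lambda>x. x ^ k"] by (simp add: gaussian_moment_def)
qed

lemma monomial_moment:
  shows integrable_monomial: "integrable P (\<lambda>w. monomial a (u w))"
    and expectation_monomial: "expectation (\<lambda>w. monomial a (u w)) = (\<Prod>i\<in>UNIV. gaussian_moment (a i))"
proof -
  have "indep_vars (\<lambda>_. borel) (\<lambda>i w. (u w $ i) ^ a i) UNIV"
    using gaussian unfolding std_gaussian_vector_def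
    by (intro indep_vars_compose2 [of _ "\<lambda>i w. u w $ i" UNIV "\<lambda>i x. x ^ a i"]) auto
  from indep_vars_integrable [OF _ this] indep_vars_lebesgue_integral [OF _ this]
  show "integrable P (\<lambda>w. monomial a (u w))"
    "expectation (\<lambda>w. monomial a (u w)) = (\<Prod>i\<in>UNIV. gaussian_moment (a i))"
    by (simp_all add: monomial_def coordinate_moment)
qed

lemma integrable_polynomial:
  fixes f :: "real^'n \<Rightarrow> real"
  assumes "real_polynomial_function f"
  shows "integrable P (\<lambda>w. f (u w))"
  using monomial_span_real_polynomial [OF assms]
  by (induction rule: monomial_span.induct) (simp_all add: integrable_monomial)

text \<open>By independence both expectations are products of one-dimensional moments differing only
  in the \<open>k\<close>-th factor, where \<open>gaussian_moment_Suc\<close> applies.\<close>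

lemma gaussian_integration_by_parts_monomial:
  "expectation (\<lambda>w. u w $ k * monomial a (u w)) =
    real (a k) * expectation (\<lambda>w. monomial (a(k := a k - 1)) (u w))"
proof -
  have eq: "x $ k * monomial a x = monomial (a(k := Suc (a k))) x" for x
  proof -
    have "(\<Prod>i\<in>UNIV - {k}. x $ i ^ a i) = (\<Prod>i\<in>UNIV - {k}. x $ i ^ (a(k := Suc (a k))) i)"
      by (intro prod.cong) auto
    then show ?thesis
      unfolding monomial_remove [of "a(k := Suc (a k))" x k] monomial_remove [of a x k]
      by (simp only: fun_upd_same power_Suc mult.assoc)
  qed
  have split: "(\<Prod>i\<in>UNIV. gaussian_moment ((a(k := m)) i))
      = gaussian_moment m * (\<Prod>i\<in>UNIV - {k}. gaussian_moment (a i))" for m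
  proof -
    have "(\<Prod>i\<in>UNIV - {k}. gaussian_moment ((a(k := m)) i)) = (\<Prod>i\<in>UNIV - {k}. gaussian_moment (a i))"
      by (intro prod.cong) auto
    then show ?thesis
      unfolding prod.remove [OF finite UNIV_I, of _ k] by (simp only: fun_upd_same)
  qed
  show ?thesis
    unfolding eq expectation_monomial split by (simp add: gaussian_moment_Suc)
qed

text \<open>Linearity reduces the claim to monomials. The derivative enters as a hypothesis on
  \<open>f'\<close>, so it may be given in whatever form the product rule produces.\<close>

lemma gaussian_integration_by_parts:
  assumes f: "real_polynomial_function f"
    and f': "\<And>x. ((\<lambda>t. f (x + t *\<^sub>R axis k 1)) has_vector_derivative f' x) (at 0)"
  shows "integrable P (\<lambda>w. f' (u w))"
    and "expectation (\<lambda>w. u w $ k * f (u w)) = expectation (\<lambda>w. f' (u w))"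
proof -
  \<comment> \<open>Integrability is carried through the induction because additivity of the
    expectation requires it.\<close>
  have "integrable P (\<lambda>w. f' (u w)) \<and> integrable P (\<lambda>w. u w $ k * f (u w)) \<and>
      expectation (\<lambda>w. u w $ k * f (u w)) = expectation (\<lambda>w. f' (u w))"
    using monomial_span_real_polynomial [OF f] f'
  proof (induction arbitrary: f' rule: monomial_span.induct)
    case zero
    have "f' x = 0" for x
      using vector_derivative_unique_at [OF zero has_vector_derivative_const] .
    then show ?case by simp
  next
    case (step f c a)
    \<comment> \<open>\<open>m\<close> is the derivative of the leading term; then
      \<open>f' - m\<close> is a derivative of the remaining sum, to which the induction hypothesis
      applies.\<close>
    define m where "m x = c * (real (a k) * monomial (a(k := a k - 1)) x)" for x
    have m: "((\<lambda>t. c * monomial a (x + t *\<^sub>R axis k 1)) has_vector_derivative m x) (at 0)" for x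
      unfolding m_def by (rule has_vector_derivative_mult_right [OF monomial_deriv])
    have "((\<lambda>t. f (x + t *\<^sub>R axis k 1)) has_vector_derivative f' x - m x) (at 0)" for x
      using has_vector_derivative_diff [OF step.prems [of x] m [of x]] by simp
    note IH = step.IH [OF this]
    have i1: "integrable P (\<lambda>w. m (u w))"
      by (simp add: m_def integrable_monomial)
    have "real_polynomial_function (\<lambda>x :: real^'n. x $ k * monomial a x)"
      unfolding monomial_def
      by (intro real_polynomial_function.intros(1,4) real_polynomial_function_prod real_polynomial_function_power
          bounded_linear_vec_nth) auto
    from integrable_polynomial [OF this]
    have i2: "integrable P (\<lambda>w. u w $ k * monomial a (u w))" .
    have i3: "integrable P (\<lambda>w. c * (u w $ k * monomial a (u w)))"
      using i2 by simp
    have f'_eq: "f' (u w) = (f' (u w) - m (u w)) + m (u w)"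
      and uk_eq: "u w $ k * (c * monomial a (u w) + f (u w)) = c * (u w $ k * monomial a (u w)) + u w $ k * f (u w)"
      for w by (simp_all add: algebra_simps)
    have "integrable P (\<lambda>w. f' (u w))"
      using Bochner_Integration.integrable_add [OF conjunct1 [OF IH] i1] by simp
    moreover have "integrable P (\<lambda>w. u w $ k * (c * monomial a (u w) + f (u w)))"
      unfolding uk_eq using i3 IH by (intro Bochner_Integration.integrable_add) auto
    moreover have "expectation (\<lambda>w. u w $ k * (c * monomial a (u w) + f (u w))) = expectation (\<lambda>w. f' (u w))"
    proof -
      have "expectation (\<lambda>w. u w $ k * (c * monomial a (u w) + f (u w)))
          = expectation (\<lambda>w. c * (u w $ k * monomial a (u w))) + expectation (\<lambda>w. u w $ k * f (u w))"
        unfolding uk_eq using i3 IH by (intro Bochner_Integration.integral_add) auto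
      also have "\<dots> = expectation (\<lambda>w. m (u w)) + expectation (\<lambda>w. f' (u w) - m (u w))"
        using IH i2 by (simp add: m_def gaussian_integration_by_parts_monomial)
      also have "\<dots> = expectation (\<lambda>w. m (u w) + (f' (u w) - m (u w)))"
        using i1 IH by (intro Bochner_Integration.integral_add [symmetric]) auto
      finally show ?thesis by simp
    qed
    ultimately show ?case by blast
  qed
  then show "integrable P (\<lambda>w. f' (u w))"
    "expectation (\<lambda>w. u w $ k * f (u w)) = expectation (\<lambda>w. f' (u w))" by auto
qed

end

section \<open>Trace moments\<close>

text \<open>Expanding both arguments in the basis leaves products of real polynomials times fixed
  vectors \<open>h b c\<close>.\<close>

lemma polynomial_function_bilinear:
  fixes h :: "'b::euclidean_space \<Rightarrow> 'c::euclidean_space \<Rightarrow> 'd::real_normed_vector"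
  assumes h: "bounded_bilinear h" and f: "polynomial_function f" and g: "polynomial_function g"
  shows "polynomial_function (\<lambda>x. h (f x) (g x))"
proof -
  interpret bounded_bilinear h by (rule h)
  have coord: "polynomial_function (\<lambda>x. k x \<bullet> b)" if "polynomial_function k" for k b
    using that bounded_linear_inner_left [of b]
    unfolding polynomial_function_def [of k] by (auto simp: o_def simp flip: real_polynomial_function_eq)
  have "h (f x) (g x) = (\<Sum>b\<in>Basis. \<Sum>c\<in>Basis. ((f x \<bullet> b) * (g x \<bullet> c)) *\<^sub>R h b c)" for x
  proof -
    have "h (f x) (g x) = h (\<Sum>b\<in>Basis. (f x \<bullet> b) *\<^sub>R b) (\<Sum>c\<in>Basis. (g x \<bullet> c) *\<^sub>R c)"
      by (simp add: euclidean_representation)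
    also have "\<dots> = (\<Sum>b\<in>Basis. \<Sum>c\<in>Basis. ((f x \<bullet> b) * (g x \<bullet> c)) *\<^sub>R h b c)"
      by (simp only: sum_left sum_right scaleR_left scaleR_right scaleR_scaleR scaleR_sum_right mult.commute)
        (rule sum.swap)
    finally show ?thesis .
  qed
  moreover have "polynomial_function (\<lambda>x. \<Sum>b\<in>Basis. \<Sum>c\<in>Basis. ((f x \<bullet> b) * (g x \<bullet> c)) *\<^sub>R h b c)"
    using polynomial_function_mult [OF coord [OF f] coord [OF g]]
    by (intro polynomial_function_sum polynomial_function_mult) auto
  ultimately show ?thesis by simp
qed

lemma polynomial_function_mpow: "polynomial_function Z \<Longrightarrow> polynomial_function (\<lambda>x. mpow (Z x) m)"
  by (induction m) (simp_all add: polynomial_function_bilinear [OF bounded_bilinear_matrix_mult])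

lemma real_polynomial_function_inner:
  fixes f g :: "'a::real_normed_vector \<Rightarrow> 'b::euclidean_space"
  shows "polynomial_function f \<Longrightarrow> polynomial_function g \<Longrightarrow> real_polynomial_function (\<lambda>x. f x \<bullet> g x)"
  by (simp add: real_polynomial_function_eq polynomial_function_bilinear [OF bounded_bilinear_inner])

text \<open>Leibniz rule for factors that do not commute in general: the sum runs over the position
  of the differentiated factor.\<close>

lemma mpow_has_vector_derivative:
  assumes Z: "(Z has_vector_derivative G) (at t)"
  shows "((\<lambda>s. mpow (Z s) m) has_vector_derivative
    (\<Sum>i<m. mpow (Z t) i ** G ** mpow (Z t) (m - Suc i))) (at t)"
proof (induction m)
  case (Suc m)
  have "((\<lambda>s. Z s ** mpow (Z s) m) has_vector_derivative
      Z t ** (\<Sum>i<m. mpow (Z t) i ** G ** mpow (Z t) (m - Suc i)) + G ** mpow (Z t) m) (at t)"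
    by (rule bounded_bilinear.has_vector_derivative [OF bounded_bilinear_matrix_mult Z Suc])
  moreover have "Z t ** (\<Sum>i<m. mpow (Z t) i ** G ** mpow (Z t) (m - Suc i)) + G ** mpow (Z t) m
      = (\<Sum>i<Suc m. mpow (Z t) i ** G ** mpow (Z t) (Suc m - Suc i))"
    unfolding sum.lessThan_Suc_shift by (simp add: matrix_mult_sum_right matrix_mul_assoc)
  ultimately show ?case by simp
qed simp

context gaussian_vector
begin

lemma integrable_inner_polynomial:
  fixes f g :: "real^'n \<Rightarrow> 'b::euclidean_space"
  assumes "polynomial_function f" "polynomial_function g"
  shows "integrable P (\<lambda>w. f (u w) \<bullet> g (u w))"
  using integrable_polynomial [OF real_polynomial_function_inner [OF assms]] .

lemma integrable_norm_polynomial: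
  fixes f :: "real^'n \<Rightarrow> 'b::euclidean_space"
  assumes "polynomial_function f"
  shows "integrable P (\<lambda>w. (norm (f (u w)))\<^sup>2)"
  using integrable_inner_polynomial [OF assms assms] by (simp add: power2_norm_eq_inner)

text \<open>One step of Tropp's moment recursion: integrate by parts in \<open>Z \<bullet> Z\<^sup>2\<^sup>q\<^sup>-\<^sup>1\<close>. The hypothesis on
  \<open>Z\<close> says that it is \<open>c\<close> times the Gaussian divergence of its own gradient, which makes
  the divergence terms cancel.\<close>

lemma trace_moment_recursion:
  fixes Z :: "real^'n \<Rightarrow> complex^'a^'a" and G :: "'n \<Rightarrow> real^'n \<Rightarrow> complex^'a^'a"
  assumes polyZ: "polynomial_function Z" and polyG: "\<And>k. polynomial_function (G k)"
    and hermZ: "\<And>x. hermitian (Z x)" and hermG: "\<And>k x. hermitian (G k x)"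
    and derivZ: "\<And>k x. ((\<lambda>t. Z (x + t *\<^sub>R axis k 1)) has_vector_derivative G k x) (at 0)"
    and derivG: "\<And>k x. ((\<lambda>t. G k (x + t *\<^sub>R axis k 1)) has_vector_derivative K k) (at 0)"
    and Z_eq: "\<And>x. Z x = c *\<^sub>R (\<Sum>k\<in>UNIV. x $ k *\<^sub>R G k x - K k)"
    and "0 \<le> c"
  shows "expectation (\<lambda>w. (norm (mpow (Z (u w)) (Suc r)))\<^sup>2)
    \<le> c * real (2 * r + 1) * expectation (\<lambda>w. \<Sum>k\<in>UNIV. (norm (G k (u w) ** mpow (Z (u w)) r))\<^sup>2)"
proof -
  let ?m = "2 * r + 1"
  \<comment> \<open>In the derivative of \<open>f k\<close>, \<open>R\<close> comes from
    differentiating the power of \<open>Z\<close> and \<open>S\<close> from differentiating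
    \<open>G k\<close>.\<close>
  define R where "R k x = G k x \<bullet> (\<Sum>i<?m. mpow (Z x) i ** G k x ** mpow (Z x) (?m - Suc i))" for k x
  define S where "S k x = K k \<bullet> mpow (Z x) ?m" for k x
  define f where "f k x = G k x \<bullet> mpow (Z x) ?m" for k x
  note pm = polynomial_function_mpow [OF polyZ]
  have polyf: "real_polynomial_function (f k)" for k
    unfolding f_def by (intro real_polynomial_function_inner polyG pm)
  have derivf: "((\<lambda>t. f k (x + t *\<^sub>R axis k 1)) has_vector_derivative R k x + S k x) (at 0)" for k x
    using bounded_bilinear.has_vector_derivative [OF bounded_bilinear_inner
        derivG [of k x] mpow_has_vector_derivative [OF derivZ [of x k], of ?m]]
    by (simp add: R_def S_def f_def)
  note ibp = gaussian_integration_by_parts [OF polyf derivf]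
  have intS: "integrable P (\<lambda>w. S k (u w))" for k
    unfolding S_def by (intro integrable_inner_polynomial pm) simp
  have intR: "integrable P (\<lambda>w. R k (u w))" for k
    using Bochner_Integration.integrable_diff [OF ibp(1) intS, of k k] by simp
  have intuf: "integrable P (\<lambda>w. u w $ k * f k (u w))" for k
  proof -
    have "real_polynomial_function (\<lambda>x. x $ k * f k x)"
      by (intro real_polynomial_function.intros(1,4) polyf bounded_linear_vec_nth)
    from integrable_polynomial [OF this] show ?thesis .
  qed
  \<comment> \<open>The subtracted \<open>S k\<close>, which stems from \<open>K k\<close> in
    \<open>Z_eq\<close>, will cancel the \<open>S k\<close> produced by integrating
    \<open>x $ k * f k x\<close> by parts.\<close>
  have norm_eq: "(norm (mpow (Z x) (Suc r)))\<^sup>2 = c * (\<Sum>k\<in>UNIV. x $ k * f k x - S k x)" for x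
  proof -
    have "(norm (mpow (Z x) (Suc r)))\<^sup>2 = (mpow (Z x) r ** Z x) \<bullet> mpow (Z x) (Suc r)"
      by (simp add: power2_norm_eq_inner mpow_commute)
    also have "\<dots> = Z x \<bullet> (mpow (Z x) r ** mpow (Z x) (Suc r))"
      by (rule hermitian_inner_left [OF hermitian_mpow [OF hermZ]])
    also have "\<dots> = Z x \<bullet> mpow (Z x) ?m"
    proof -
      have "?m = r + Suc r" by simp
      then show ?thesis by (simp only: mpow_add)
    qed
    also have "\<dots> = c * (\<Sum>k\<in>UNIV. x $ k * f k x - S k x)"
      by (subst Z_eq) (simp add: f_def S_def inner_sum_left inner_diff_left del: mpow.simps)
    finally show ?thesis .
  qed
  \<comment> \<open>Each of the \<open>?m\<close> summands has exponents \<open>i\<close> and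
    \<open>2 * r - i\<close>, whose sum is even, so \<open>inner_sandwich_le\<close> applies with
    \<open>c = r\<close>.\<close>
  have R_le: "R k x \<le> real ?m * (norm (G k x ** mpow (Z x) r))\<^sup>2" for k x
  proof -
    have "R k x \<le> (\<Sum>i<?m. (norm (G k x ** mpow (Z x) r))\<^sup>2)"
      unfolding R_def inner_sum_right
      by (intro sum_mono inner_sandwich_le hermZ hermG) auto
    then show ?thesis by simp
  qed
  have intG: "integrable P (\<lambda>w. (norm (G k (u w) ** mpow (Z (u w)) r))\<^sup>2)" for k
    by (intro integrable_norm_polynomial polynomial_function_bilinear [OF bounded_bilinear_matrix_mult] polyG pm)
  have "expectation (\<lambda>w. (norm (mpow (Z (u w)) (Suc r)))\<^sup>2)
      = c * (\<Sum>k\<in>UNIV. expectation (\<lambda>w. u w $ k * f k (u w)) - expectation (\<lambda>w. S k (u w)))"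
    unfolding norm_eq using intuf intS by simp
  also have "\<dots> = c * (\<Sum>k\<in>UNIV. expectation (\<lambda>w. R k (u w)))"
    using ibp(2) intR intS by simp
  also have "\<dots> \<le> c * (\<Sum>k\<in>UNIV. expectation (\<lambda>w. real ?m * (norm (G k (u w) ** mpow (Z (u w)) r))\<^sup>2))"
    using \<open>0 \<le> c\<close> R_le intG intR
    by (intro mult_left_mono sum_mono integral_mono) (auto simp del: of_nat_add of_nat_mult)
  also have "\<dots> = c * real ?m * expectation (\<lambda>w. \<Sum>k\<in>UNIV. (norm (G k (u w) ** mpow (Z (u w)) r))\<^sup>2)"
    using intG by (simp add: sum_distrib_left mult.assoc)
  finally show ?thesis .
qed

end

section \<open>Block matrices\<close>

text \<open>Only the row index is split: left multiplication by a block matrix then acts on block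
  rows while the columns stay whole.\<close>

definition block_row :: "complex^'c^('n::finite \<times> 'p::finite) \<Rightarrow> 'n \<Rightarrow> complex^'c^'p" where
  "block_row X i = (\<chi> j. X $ (i, j))"

lemma block_row_nth [simp]: "block_row X i $ j = X $ (i, j)"
  by (simp add: block_row_def)

lemma block_row_minus: "block_row (- X) i = - block_row X i"
  by (simp add: vec_eq_iff)

lemma sum_UNIV_option: "(\<Sum>x\<in>UNIV. f x) = f None + (\<Sum>i\<in>UNIV. f (Some i))"
  for f :: "'n::finite option \<Rightarrow> 'b::comm_monoid_add"
  by (simp add: UNIV_option_conv sum.reindex)

lemma sum_UNIV_prod: "(\<Sum>x\<in>UNIV. f x) = (\<Sum>i\<in>UNIV. \<Sum>j\<in>UNIV. f (i, j))"
  for f :: "'n::finite \<times> 'p::finite \<Rightarrow> 'b::comm_monoid_add"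
  by (simp add: sum.cartesian_product flip: UNIV_Times_UNIV)

lemma inner_block_rows: "X \<bullet> Y = block_row X None \<bullet> block_row Y None
    + (\<Sum>i\<in>UNIV. block_row X (Some i) \<bullet> block_row Y (Some i))"
  for X Y :: "complex^'c^('n::finite option \<times> 'p::finite)"
  by (simp add: inner_vec_def sum_UNIV_prod sum_UNIV_option)

lemma norm_block_rows: "(norm X)\<^sup>2 = (norm (block_row X None))\<^sup>2 + (\<Sum>i\<in>UNIV. (norm (block_row X (Some i)))\<^sup>2)"
  for X :: "complex^'c^('n::finite option \<times> 'p::finite)"
  by (simp add: power2_norm_eq_inner inner_block_rows)

text \<open>The Hermitian dilation of the column of blocks \<open>F i\<close>, the block indexed by \<open>None\<close> being
  the tip of the arrow.\<close>

definition arrow :: "('n::finite \<Rightarrow> complex^'p::finite^'p) \<Rightarrow> complex^('n option \<times> 'p)^('n option \<times> 'p)" where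
  "arrow F = (\<chi> a b. case (fst a, fst b) of
      (None, Some i) \<Rightarrow> F i $ snd a $ snd b
    | (Some i, None) \<Rightarrow> F i $ snd a $ snd b
    | _ \<Rightarrow> 0)"

lemma hermitian_arrow: "(\<And>i. hermitian (F i)) \<Longrightarrow> hermitian (arrow F)"
  by (auto simp: hermitian_def vec_eq_iff arrow_def split: option.splits)

lemma block_row_arrow:
  "block_row (arrow F ** X) None = (\<Sum>i\<in>UNIV. F i ** block_row X (Some i))"
  "block_row (arrow F ** X) (Some i) = F i ** block_row X None"
  by (simp_all add: vec_eq_iff matrix_matrix_mult_def arrow_def sum_UNIV_prod sum_UNIV_option)

lemma arrow_add: "arrow (\<lambda>i. F i + G i) = arrow F + arrow G"
  by (auto simp: vec_eq_iff arrow_def split: option.splits)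

lemma arrow_scaleR: "arrow (\<lambda>i. c *\<^sub>R F i) = c *\<^sub>R arrow F"
  by (auto simp: vec_eq_iff arrow_def split: option.splits)

text \<open>Brings \<open>A\<close> to the size of \<open>arrow F\<close>, so that Young's
  inequality can combine the two.\<close>

definition corner :: "complex^'p::finite^'p \<Rightarrow> complex^('n::finite option \<times> 'p::finite)^('n option \<times> 'p)" where
  "corner A = (\<chi> a b. if fst a = None \<and> fst b = None then A $ snd a $ snd b else 0)"

lemma hermitian_corner: "hermitian A \<Longrightarrow> hermitian (corner A)"
  by (auto simp: hermitian_def vec_eq_iff corner_def)

lemma block_row_corner:
  "block_row (corner A ** X) None = A ** block_row X None"
  "block_row (corner A ** X) (Some i) = 0"
  by (simp_all add: vec_eq_iff matrix_matrix_mult_def corner_def sum_UNIV_prod sum_UNIV_option)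

text \<open>The diagonal sign matrix separating the tip from the other blocks; it anticommutes with
  every arrow.\<close>

definition grading :: "complex^('n::finite option \<times> 'p::finite)^('n option \<times> 'p)" where
  "grading = (\<chi> a b. if a = b then if fst a = None then 1 else - 1 else 0)"

lemma block_row_grading:
  "block_row (grading ** X) None = block_row X None"
  "block_row (grading ** X) (Some i) = - block_row X (Some i)"
  by (simp_all add: vec_eq_iff matrix_matrix_mult_def grading_def if_distrib [of "\<lambda>x. x * _"] cong: if_cong)

lemma eq_block_rowsI:
  fixes X Y :: "complex^'c^('n::finite option \<times> 'p::finite)"
  assumes "block_row X None = block_row Y None" "\<And>i. block_row X (Some i) = block_row Y (Some i)"
  shows "X = Y"
proof -
  have "block_row X x = block_row Y x" for x
    using assms by (cases x) auto
  then have "X $ (x, j) = Y $ (x, j)" for x j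
    by (metis block_row_nth)
  then show ?thesis by (simp add: vec_eq_iff)
qed

lemma grading_arrow: "grading ** (arrow F ** X) = - (arrow F ** (grading ** X))"
  by (rule eq_block_rowsI)
    (simp_all add: block_row_minus block_row_grading block_row_arrow matrix_mult_minus_right sum_negf)

text \<open>Anticommutation with \<open>grading\<close> makes the inner product of the power with
  its graded copy vanish. That product is the difference of the two row contributions, so each is
  half of the total.\<close>

lemma norm_block_row_arrow_mpow:
  assumes "\<And>i. hermitian (F i)" and "0 < m"
  shows "(norm (block_row (mpow (arrow F) m) None))\<^sup>2 = (norm (mpow (arrow F) m))\<^sup>2 / 2"
    and "(\<Sum>i\<in>UNIV. (norm (block_row (mpow (arrow F) m) (Some i)))\<^sup>2) = (norm (mpow (arrow F) m))\<^sup>2 / 2"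
proof -
  let ?D = "arrow F"
  note D = hermitian_arrow [of F, OF assms(1)]
  obtain r where m: "m = Suc r" using \<open>0 < m\<close> by (cases m) auto
  define a where "a = mpow ?D r"
  have X: "mpow ?D m = ?D ** a" "mpow ?D m = a ** ?D"
    by (simp_all add: m a_def mpow_commute)
  \<comment> \<open>A factor \<open>?D\<close> leaves the second argument on the right and returns
    to it on the left, where passing \<open>grading\<close> costs a sign.\<close>
  have "(?D ** a) \<bullet> (grading ** (?D ** a)) = (a ** ?D) \<bullet> (grading ** (a ** ?D))"
    using X by simp
  also have "\<dots> = (a ** ?D) \<bullet> ((grading ** a) ** ?D)"
    by (simp add: matrix_mul_assoc)
  also have "\<dots> = (a ** ?D ** ?D) \<bullet> (grading ** a)"
    by (rule hermitian_inner_right [OF D, symmetric])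
  also have "\<dots> = (?D ** (?D ** a)) \<bullet> (grading ** a)"
    using X by (metis matrix_mul_assoc)
  also have "\<dots> = (?D ** a) \<bullet> (?D ** (grading ** a))"
    by (rule hermitian_inner_left [OF D])
  also have "\<dots> = - ((?D ** a) \<bullet> (grading ** (?D ** a)))"
    by (simp add: grading_arrow)
  finally have "mpow ?D m \<bullet> (grading ** mpow ?D m) = 0"
    using X by simp
  then have "(norm (block_row (mpow ?D m) None))\<^sup>2 = (\<Sum>i\<in>UNIV. (norm (block_row (mpow ?D m) (Some i)))\<^sup>2)"
    by (simp add: inner_block_rows block_row_grading power2_norm_eq_inner sum_negf)
  with norm_block_rows [of "mpow ?D m"]
  show "(norm (block_row (mpow ?D m) None))\<^sup>2 = (norm (mpow ?D m))\<^sup>2 / 2"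
    "(\<Sum>i\<in>UNIV. (norm (block_row (mpow ?D m) (Some i)))\<^sup>2) = (norm (mpow ?D m))\<^sup>2 / 2"
    by simp_all
qed


text \<open>This block row of the identity is (1 0 ... 0). Its rows are orthonormal, so multiplying
  by it on the right preserves the norm.\<close>

lemma norm_mult_block_row_mat_1:
  fixes A :: "complex^'p^'p"
  shows "norm (A ** block_row (mat 1 :: complex^('n::finite option \<times> 'p)^('n option \<times> 'p)) None) = norm A"
proof -
  let ?I = "block_row (mat 1 :: complex^('n option \<times> 'p)^('n option \<times> 'p)) None"
  have "A ** (?I ** conj_transpose ?I) = A"
  proof -
    have "?I ** conj_transpose ?I = mat 1"
      by (simp add: vec_eq_iff matrix_matrix_mult_def mat_def sum_UNIV_prod sum_UNIV_option
          if_distrib [of cnj] if_distrib [of "\<lambda>x. x * _"] cong: if_cong)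
    then show ?thesis by simp
  qed
  then have "(A ** ?I) \<bullet> (A ** ?I) = A \<bullet> A"
    by (simp add: inner_matrix_mult_right flip: matrix_mul_assoc)
  then show ?thesis by (simp add: norm_eq_sqrt_inner)
qed

lemma norm_block_row_mat_1:
  "(norm (block_row (mat 1 :: complex^('n::finite option \<times> 'p::finite)^('n option \<times> 'p)) None))\<^sup>2 = real CARD('p)"
proof -
  have "norm (block_row (mat 1 :: complex^('n option \<times> 'p)^('n option \<times> 'p)) None) = norm (mat 1 :: complex^'p^'p)"
    using norm_mult_block_row_mat_1 [of "mat 1 :: complex^'p^'p"] by simp
  moreover have "(norm (mat 1 :: complex^'p^'p))\<^sup>2 = real CARD('p)"
    by (simp add: power2_norm_eq_inner inner_vec_def mat_def inner_complex_def if_distrib [of Re]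
        if_distrib [of Im] if_distrib [of "\<lambda>x. x * _"] cong: if_cong)
  ultimately show ?thesis by metis
qed

lemma block_row_mpow_corner:
  "block_row (mpow (corner A :: complex^('n::finite option \<times> 'p::finite)^('n option \<times> 'p)) q) None
    = mpow A q ** block_row (mat 1) None"
  by (induction q) (simp_all add: block_row_corner matrix_mul_assoc)

lemma norm_mpow_corner:
  assumes "0 < q"
  shows "norm (mpow (corner A :: complex^('n::finite option \<times> 'p::finite)^('n option \<times> 'p)) q) = norm (mpow A q)"
proof -
  let ?C = "corner A :: complex^('n::finite option \<times> 'p::finite)^('n option \<times> 'p)"
  have "block_row (mpow ?C q) (Some i) = 0" for i
    using assms by (cases q) (simp_all add: block_row_corner)
  then have "(norm (mpow ?C q))\<^sup>2 = (norm (mpow A q))\<^sup>2"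
    by (simp add: norm_block_rows block_row_mpow_corner norm_mult_block_row_mat_1)
  then show ?thesis by simp
qed

text \<open>The rows \<open>Some i\<close> of the product on the right contribute exactly the left
  side. A sum over gradient matrices thus becomes a single product of two Hermitian
  matrices.\<close>

lemma sum_norm_le_norm_arrow_corner:
  "(\<Sum>i\<in>UNIV. (norm (F i ** mpow A q))\<^sup>2) \<le> (norm (arrow F ** mpow (corner A) q))\<^sup>2"
proof -
  have "(\<Sum>i\<in>UNIV. (norm (F i ** mpow A q))\<^sup>2)
      = (\<Sum>i\<in>UNIV. (norm (block_row (arrow F ** mpow (corner A) q) (Some i)))\<^sup>2)"
    by (simp add: block_row_arrow block_row_mpow_corner matrix_mul_assoc norm_mult_block_row_mat_1)
  then show ?thesis
    by (simp add: norm_block_rows [of "arrow F ** mpow (corner A) q"])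
qed

section \<open>Hermitian Gaussian chaos of order two\<close>

text \<open>Bernoulli's inequality gives (1 + 1/r)^r \<ge> 2. The estimate bounds the product of the
  odd factors arising in the moment recursion by r^r.\<close>

lemma Suc_power_growth: "real (2 * r + 1) * real r ^ r \<le> real (Suc r) ^ Suc r"
proof (cases "r = 0")
  case False
  then obtain s where r: "r = Suc s" using not0_implies_Suc by blast
  have "1 + real r * (1 / real r) \<le> (1 + 1 / real r) ^ r"
    by (rule Bernoulli_inequality) (smt (verit) divide_nonneg_nonneg of_nat_0_le_iff)
  then have "2 * real r ^ r \<le> (1 + 1 / real r) ^ r * real r ^ r"
    using False by (intro mult_right_mono) auto
  also have "\<dots> = real (Suc r) ^ r"
    using False by (simp add: field_simps flip: power_mult_distrib)
  finally have "real (Suc r) * (2 * real r ^ r) \<le> real (Suc r) ^ Suc r"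
    by (simp add: mult_left_mono del: of_nat_Suc)
  moreover have "real (2 * r + 1) * real r ^ r \<le> real (Suc r) * (2 * real r ^ r)"
    by (simp add: algebra_simps)
  ultimately show ?thesis by linarith
qed simp

context gaussian_vector
begin

text \<open>By symmetry \<open>H (axis k 1) x\<close> is the \<open>k\<close>-th partial derivative
  of \<open>Z\<close>. The recursion is used twice: for \<open>Z\<close>, and for the Hermitian
  dilation of its gradient, whose own gradient is constant. \<open>v1\<close> and \<open>v2\<close>
  bound the action of that constant gradient on the tip row and on the other rows.\<close>

lemma hermitian_chaos_moment:
  fixes H :: "real^'n \<Rightarrow> real^'n \<Rightarrow> complex^'p::finite^'p"
  defines "Z \<equiv> \<lambda>x. (1/2) *\<^sub>R (H x x - (\<Sum>k\<in>UNIV. H (axis k 1) (axis k 1)))"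
  assumes bil: "bounded_bilinear H" and sym: "\<And>x y. H x y = H y x" and herm: "\<And>x y. hermitian (H x y)"
    and v1: "\<And>Y :: complex^('n option \<times> 'p)^'p.
      (\<Sum>k\<in>UNIV. \<Sum>i\<in>UNIV. (norm (H (axis i 1) (axis k 1) ** Y))\<^sup>2) \<le> v1 * (norm Y)\<^sup>2"
    and v2: "\<And>Y :: 'n \<Rightarrow> complex^('n option \<times> 'p)^'p.
      (\<Sum>k\<in>UNIV. (norm (\<Sum>i\<in>UNIV. H (axis i 1) (axis k 1) ** Y i))\<^sup>2) \<le> v2 * (\<Sum>i\<in>UNIV. (norm (Y i))\<^sup>2)"
    and "0 \<le> v1" "0 \<le> v2" and q: "0 < q"
  shows "expectation (\<lambda>w. (norm (mpow (Z (u w)) q))\<^sup>2)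
    \<le> 4 * real CARD('p) * ((real q)\<^sup>2 * ((v1 + v2) / 2)) ^ q"
proof -
  interpret H: bounded_bilinear H by (rule bil)
  define e where "e k = (axis k 1 :: real^'n)" for k
  define D where "D x = arrow (\<lambda>i. H (e i) x)" for x
  define \<alpha> where "\<alpha> = (v1 + v2) / 2"
  have \<alpha>: "0 \<le> \<alpha>" "v1 \<le> 2 * \<alpha>" using \<open>0 \<le> v1\<close> \<open>0 \<le> v2\<close> by (auto simp: \<alpha>_def)
  have linD: "linear D"
  proof (rule linearI)
    show "D (x + y) = D x + D y" for x y
      by (simp add: D_def H.add_right arrow_add)
    show "D (c *\<^sub>R x) = c *\<^sub>R D x" for c x
      by (simp add: D_def H.scaleR_right arrow_scaleR)
  qed
  then have blD: "bounded_linear D" by (simp add: linear_conv_bounded_linear)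
  have polyD: "polynomial_function D" by (rule polynomial_function_bounded_linear [OF blD])
  have hermD: "hermitian (D x)" for x unfolding D_def by (intro hermitian_arrow herm)
  have expand: "x = (\<Sum>k\<in>UNIV. x $ k *\<^sub>R e k)" for x
    using basis_expansion [of x] by (simp add: scalar_mult_eq_scaleR e_def)
  have line: "((\<lambda>t. x + t *\<^sub>R e k) has_vector_derivative e k) (at 0)" for x k
    by (auto intro!: derivative_eq_intros)
  have derivD: "((\<lambda>t. D (x + t *\<^sub>R e k)) has_vector_derivative D (e k)) (at 0)" for x k
    by (rule bounded_linear.has_vector_derivative [OF blD line])
  \<comment> \<open>A linear map satisfies the hypothesis of the recursion with constant 1 and no
    correction term.\<close>
  have D_eq: "D x = 1 *\<^sub>R (\<Sum>k\<in>UNIV. x $ k *\<^sub>R D (e k) - 0)" for x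
    by (subst expand [of x]) (simp add: linear_sum [OF linD] linear_cmul [OF linD])
  define w where "w q = expectation (\<lambda>w. (norm (mpow (D (u w)) q))\<^sup>2)" for q
  have step: "w (Suc r) \<le> real (2 * r + 1) * expectation (\<lambda>w. \<Sum>k\<in>UNIV. (norm (D (e k) ** mpow (D (u w)) r))\<^sup>2)" for r
    unfolding w_def
    using trace_moment_recursion [of D "\<lambda>k x. D (e k)" "\<lambda>k. 0" 1 r, folded e_def,
        OF polyD polynomial_function_const hermD hermD derivD has_vector_derivative_const D_eq]
    by simp
  have intD: "integrable P (\<lambda>w. (norm (mpow (D (u w)) r))\<^sup>2)" for r
    by (intro integrable_norm_polynomial polynomial_function_mpow polyD)
  have intGD: "integrable P (\<lambda>w. (norm (D (e k) ** mpow (D (u w)) r))\<^sup>2)" for k r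
    by (intro integrable_norm_polynomial polynomial_function_bilinear [OF bounded_bilinear_matrix_mult]
        polynomial_function_mpow polyD) simp
  \<comment> \<open>The zeroth power is the identity, whose norm is not shared evenly between the
    tip and the other rows. The first moment is therefore computed directly.\<close>
  have w1: "w 1 \<le> 4 * real CARD('p) * \<alpha>"
  proof -
    have "w 1 \<le> (\<Sum>k\<in>UNIV. (norm (D (e k)))\<^sup>2)"
      using step [of 0] by (simp add: prob_space)
    also have "\<dots> = (\<Sum>k\<in>UNIV. 2 * (\<Sum>i\<in>UNIV. (norm (block_row (D (e k)) (Some i)))\<^sup>2))"
      using norm_block_row_arrow_mpow(2) [of "\<lambda>i. H (e i) (e k)" 1 for k] herm
      by (intro sum.cong) (simp_all add: D_def mult.commute)
    also have "\<dots> = 2 * (\<Sum>k\<in>UNIV. \<Sum>i\<in>UNIV. (norm (H (e i) (e k) ** block_row (mat 1 :: complex^('n option \<times> 'p)^('n option \<times> 'p)) None))\<^sup>2)"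
      using block_row_arrow(2) [of _ "mat 1 :: complex^('n option \<times> 'p)^('n option \<times> 'p)"]
      by (simp add: D_def sum_distrib_left)
    also have "\<dots> \<le> 2 * (v1 * real CARD('p))"
      using v1 [folded e_def, of "block_row (mat 1 :: complex^('n option \<times> 'p)^('n option \<times> 'p)) None"]
      by (simp add: norm_block_row_mat_1)
    also have "\<dots> \<le> 2 * (2 * \<alpha> * real CARD('p))"
      using \<alpha> by (intro mult_left_mono mult_right_mono) auto
    finally show ?thesis by (simp add: mult_ac)
  qed
  \<comment> \<open>For positive \<open>r\<close> the tip row and the remaining rows carry half the
    norm each, so the average \<alpha> of \<open>v1\<close> and \<open>v2\<close> appears.\<close>
  have wSuc: "w (Suc r) \<le> real (2 * r + 1) * (\<alpha> * w r)" if "0 < r" for r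
  proof -
    have "(\<Sum>k\<in>UNIV. (norm (D (e k) ** mpow (D x) r))\<^sup>2) \<le> \<alpha> * (norm (mpow (D x) r))\<^sup>2" for x
    proof -
      let ?X = "mpow (D x) r"
      have "(\<Sum>k\<in>UNIV. (norm (D (e k) ** ?X))\<^sup>2)
          = (\<Sum>k\<in>UNIV. (norm (\<Sum>i\<in>UNIV. H (e i) (e k) ** block_row ?X (Some i)))\<^sup>2)
            + (\<Sum>k\<in>UNIV. \<Sum>i\<in>UNIV. (norm (H (e i) (e k) ** block_row ?X None))\<^sup>2)"
        unfolding D_def [of "e _"] norm_block_rows [of "arrow _ ** _"] block_row_arrow by (simp add: sum.distrib)
      also have "\<dots> \<le> v2 * (\<Sum>i\<in>UNIV. (norm (block_row ?X (Some i)))\<^sup>2) + v1 * (norm (block_row ?X None))\<^sup>2"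
        by (intro add_mono v1 [folded e_def] v2 [folded e_def])
      also have "\<dots> = \<alpha> * (norm ?X)\<^sup>2"
        unfolding D_def norm_block_row_arrow_mpow [of "\<lambda>i. H (e i) x", OF herm that]
        by (simp add: \<alpha>_def field_simps)
      finally show ?thesis .
    qed
    then have "expectation (\<lambda>w. \<Sum>k\<in>UNIV. (norm (D (e k) ** mpow (D (u w)) r))\<^sup>2)
        \<le> expectation (\<lambda>w. \<alpha> * (norm (mpow (D (u w)) r))\<^sup>2)"
      using intGD intD by (intro integral_mono) auto
    also have "\<dots> = \<alpha> * w r" by (simp add: w_def)
    finally have "real (2 * r + 1) * expectation (\<lambda>w. \<Sum>k\<in>UNIV. (norm (D (e k) ** mpow (D (u w)) r))\<^sup>2)
        \<le> real (2 * r + 1) * (\<alpha> * w r)"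
      by (rule mult_left_mono) simp
    with step [of r] show ?thesis by linarith
  qed
  have w_le: "w (Suc r) \<le> 4 * real CARD('p) * (real (Suc r) ^ Suc r * \<alpha> ^ Suc r)" for r
  proof (induction r)
    case 0
    then show ?case using w1 by simp
  next
    case (Suc r)
    have "w (Suc (Suc r)) \<le> real (2 * Suc r + 1) * (\<alpha> * w (Suc r))"
      by (rule wSuc) simp
    also have "\<dots> \<le> real (2 * Suc r + 1) * (\<alpha> * (4 * real CARD('p) * (real (Suc r) ^ Suc r * \<alpha> ^ Suc r)))"
      using \<alpha> by (intro mult_left_mono Suc.IH) auto
    also have "\<dots> = 4 * real CARD('p) * (real (2 * Suc r + 1) * real (Suc r) ^ Suc r) * \<alpha> ^ Suc (Suc r)"
      by (simp add: mult_ac del: of_nat_Suc)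
    also have "\<dots> \<le> 4 * real CARD('p) * (real (Suc (Suc r)) ^ Suc (Suc r)) * \<alpha> ^ Suc (Suc r)"
      using \<alpha> by (intro mult_right_mono mult_left_mono Suc_power_growth) auto
    finally show ?case by (simp add: mult.assoc)
  qed
  have hermZ: "hermitian (Z x)" for x
    using herm by (simp add: Z_def hermitian_def linear_cmul [OF bounded_linear.linear [OF bounded_linear_conj_transpose]]
        linear_diff [OF bounded_linear.linear [OF bounded_linear_conj_transpose]]
        linear_sum [OF bounded_linear.linear [OF bounded_linear_conj_transpose]])
  have polyG: "polynomial_function (\<lambda>x. H (e k) x)" for k
    by (rule polynomial_function_bounded_linear [OF H.bounded_linear_right])
  have polyZ: "polynomial_function Z"
    unfolding Z_def
    by (intro polynomial_function_cmul polynomial_function_diff polynomial_function_bilinear [OF bil]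
        polynomial_function_id polynomial_function_const)
  have derivG: "((\<lambda>t. H (e k) (x + t *\<^sub>R e k)) has_vector_derivative H (e k) (e k)) (at 0)" for k x
    by (rule bounded_linear.has_vector_derivative [OF H.bounded_linear_right line])
  have derivZ: "((\<lambda>t. Z (x + t *\<^sub>R e k)) has_vector_derivative H (e k) x) (at 0)" for k x
  proof -
    have "((\<lambda>t. H (x + t *\<^sub>R e k) (x + t *\<^sub>R e k)) has_vector_derivative H x (e k) + H (e k) x) (at 0)"
      using H.has_vector_derivative [OF line line, of x k x k] by simp
    then have "((\<lambda>t. Z (x + t *\<^sub>R e k)) has_vector_derivative (1/2) *\<^sub>R (H x (e k) + H (e k) x - 0)) (at 0)"
      unfolding Z_def
      by (intro bounded_linear.has_vector_derivative [OF bounded_linear_scaleR_right]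
          has_vector_derivative_diff has_vector_derivative_const)
    then show ?thesis by (simp add: sym [of x] flip: scaleR_2)
  qed
  \<comment> \<open>Expanding one argument of \<open>H x x\<close> gives the hypothesis of the
    recursion with constant 1/2.\<close>
  have Z_eq: "Z x = (1/2) *\<^sub>R (\<Sum>k\<in>UNIV. x $ k *\<^sub>R H (e k) x - H (e k) (e k))" for x
  proof -
    have "H x x = (\<Sum>k\<in>UNIV. x $ k *\<^sub>R H (e k) x)"
      by (subst (1) expand [of x]) (simp only: H.sum_left H.scaleR_left)
    then show ?thesis by (simp add: Z_def e_def sum_subtractf)
  qed
  obtain r where r: "q = Suc r" using q by (cases q) auto
  \<comment> \<open>The factor produced by the recursion, equal to q - 1/2.\<close>
  define c where "c = real (2 * r + 1) / 2"
  have c: "0 < c" "c \<le> real q" by (auto simp: c_def r)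
  let ?y = "expectation (\<lambda>w. (norm (mpow (Z (u w)) q))\<^sup>2)"
  have intZ: "integrable P (\<lambda>w. (norm (mpow (Z (u w)) q))\<^sup>2)"
    by (intro integrable_norm_polynomial polynomial_function_mpow polyZ)
  have intGZ: "integrable P (\<lambda>w. (norm (H (e k) (u w) ** mpow (Z (u w)) r))\<^sup>2)" for k
    by (intro integrable_norm_polynomial polynomial_function_bilinear [OF bounded_bilinear_matrix_mult]
        polynomial_function_mpow polyZ polyG)
  have "?y \<le> (1/2) * real (2 * r + 1) * expectation (\<lambda>w. \<Sum>k\<in>UNIV. (norm (H (e k) (u w) ** mpow (Z (u w)) r))\<^sup>2)"
    unfolding r
    by (rule trace_moment_recursion [of Z "\<lambda>k. H (e k)" "\<lambda>k. H (e k) (e k)" "1/2" r, folded e_def,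
          OF polyZ polyG hermZ herm derivZ derivG Z_eq]) simp
  then have "real q * ?y \<le> real q * (c * expectation (\<lambda>w. \<Sum>k\<in>UNIV. (norm (H (e k) (u w) ** mpow (Z (u w)) r))\<^sup>2))"
    by (intro mult_left_mono) (auto simp: c_def)
  also have "\<dots> = expectation (\<lambda>w. real q * (c * (\<Sum>k\<in>UNIV. (norm (H (e k) (u w) ** mpow (Z (u w)) r))\<^sup>2)))"
    by simp
  also have "\<dots> \<le> expectation (\<lambda>w. real r * (norm (mpow (Z (u w)) q))\<^sup>2 + c ^ q * (norm (mpow (D (u w)) q))\<^sup>2)"
  proof (rule integral_mono)
    fix \<omega>
    let ?x = "u \<omega>"
    \<comment> \<open>The gradient is packed into \<open>D\<close> and \<open>Z\<close> into a
      corner; Young's inequality then separates their powers.\<close>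
    have "real q * (c * (\<Sum>k\<in>UNIV. (norm (H (e k) ?x ** mpow (Z ?x) r))\<^sup>2))
        \<le> real q * (c * (norm (D ?x ** mpow (corner (Z ?x)) r))\<^sup>2)"
      unfolding D_def using c by (intro mult_left_mono sum_norm_le_norm_arrow_corner) auto
    also have "\<dots> \<le> real r * (norm (mpow (Z ?x) q))\<^sup>2 + c ^ q * (norm (mpow (D ?x) q))\<^sup>2"
      using hermitian_Young_scaled [OF hermD hermitian_corner [OF hermZ] q c(1), of ?x ?x] q
      by (simp add: norm_mpow_corner r del: mpow.simps)
    finally show "real q * (c * (\<Sum>k\<in>UNIV. (norm (H (e k) ?x ** mpow (Z ?x) r))\<^sup>2))
        \<le> real r * (norm (mpow (Z ?x) q))\<^sup>2 + c ^ q * (norm (mpow (D ?x) q))\<^sup>2" .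
  qed (use intGZ intZ intD in auto)
  also have "\<dots> = real r * ?y + c ^ q * w q"
    using intZ intD by (simp add: w_def)
  \<comment> \<open>Since \<open>q = Suc r\<close>, absorbing \<open>real r * ?y\<close> on the left
    leaves exactly one \<open>?y\<close>.\<close>
  finally have "?y \<le> c ^ q * w q"
    by (simp add: r algebra_simps)
  also have "\<dots> \<le> real q ^ q * (4 * real CARD('p) * (real q ^ q * \<alpha> ^ q))"
    using c w_le [of r] unfolding r
    by (intro mult_mono power_mono) (auto simp: w_def)
  also have "\<dots> = 4 * real CARD('p) * ((real q)\<^sup>2 * \<alpha>) ^ q"
    by (simp add: power_mult_distrib power2_eq_square mult_ac)
  finally show ?thesis unfolding \<alpha>_def .
qed

end

section \<open>Gram matrices of matrix families\<close>

lemma column_matrix_matrix_mult: "column b (A ** Y) = A *v column b Y"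
  by (simp add: vec_eq_iff column_def matrix_matrix_mult_def matrix_vector_mult_def)

lemma column_sum: "column b (\<Sum>i\<in>I. Y i) = (\<Sum>i\<in>I. column b (Y i))"
  by (simp add: vec_eq_iff column_def)

lemma norm_columns: "(norm Y)\<^sup>2 = (\<Sum>b\<in>UNIV. (norm (column b Y))\<^sup>2)" for Y :: "complex^'c^'p"
proof -
  have "Y \<bullet> Y = (\<Sum>i\<in>UNIV. \<Sum>b\<in>UNIV. Y $ i $ b \<bullet> Y $ i $ b)"
    by (simp add: inner_vec_def)
  also have "\<dots> = (\<Sum>b\<in>UNIV. column b Y \<bullet> column b Y)"
    by (subst sum.swap) (simp add: inner_vec_def column_def)
  finally show ?thesis by (simp add: power2_norm_eq_inner)
qed

lemma norm_add_power2_le: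
  fixes a b :: "'a::real_inner"
  shows "(norm (a + b))\<^sup>2 \<le> 2 * (norm a)\<^sup>2 + 2 * (norm b)\<^sup>2"
  using inner_le_half_norms [of a b]
  by (simp add: power2_norm_eq_inner inner_add_left inner_add_right inner_commute)

lemma power2_norm_vec: "(norm v)\<^sup>2 = (\<Sum>i\<in>UNIV. (norm (v $ i))\<^sup>2)" for v :: "complex^'n"
  by (simp add: norm_vec_def L2_set_def sum_nonneg)

text \<open>With v the vector on the left, |v|^2 is the inner product of A v and w, hence at most
  ||A|| |v| |w|; then |v| cancels.\<close>

lemma norm_conj_transpose_vector_le:
  fixes A :: "complex^'n^'m"
  shows "norm (conj_transpose A *v w) \<le> spectral_norm A * norm w"
proof -
  let ?v = "conj_transpose A *v w"
  have "norm ?v * norm ?v = (A *v ?v) \<bullet> w"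
    by (simp add: inner_matrix_vector flip: power2_norm_eq_inner power2_eq_square)
  also have "\<dots> \<le> norm (A *v ?v) * norm w"
    by (rule norm_cauchy_schwarz)
  also have "\<dots> \<le> (spectral_norm A * norm ?v) * norm w"
    by (intro mult_right_mono norm_matrix_vector_le_spectral) auto
  finally have "norm ?v * norm ?v \<le> (spectral_norm A * norm w) * norm ?v"
    by (simp add: mult_ac)
  then show ?thesis
    using spectral_norm_nonneg [of A] by (cases "norm ?v = 0") auto
qed

lemma linear_column_matrix: "linear (column_matrix X)"
  by (rule linearI)
    (simp_all add: vec_eq_iff column_matrix_def complex_vec_def matrix_vector_mult_def algebra_simps
      sum.distrib scaleR_conv_of_real [where 'a = complex] sum_distrib_left)

lemma column_matrix_axis: "column_matrix X (axis i 1) $ a $ j = X j $ a $ i"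
proof -
  have "(\<Sum>k\<in>UNIV. X j $ a $ k * complex_of_real (axis i 1 $ k)) = (\<Sum>k\<in>UNIV. if k = i then X j $ a $ k else 0)"
    by (intro sum.cong) (auto simp: axis_def)
  then show ?thesis
    by (simp add: column_matrix_def complex_vec_def matrix_vector_mult_def)
qed

lemma gram_matrix_eq_sum:
  "gram_matrix X = (\<Sum>k\<in>UNIV. conj_transpose (column_matrix X (axis k 1)) ** column_matrix X (axis k 1))"
  by (simp add: vec_eq_iff gram_matrix_def frobenius_inner_def trace_def matrix_matrix_mult_def
      column_matrix_axis)

lemma sum_norm_column_matrix_vector_le:
  fixes X :: "'p::finite \<Rightarrow> complex^'n^'m"
  shows "(\<Sum>k\<in>UNIV. (norm (column_matrix X (axis k 1) *v x))\<^sup>2) \<le> spectral_norm (gram_matrix X) * (norm x)\<^sup>2"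
proof -
  have "(\<Sum>k\<in>UNIV. (norm (column_matrix X (axis k 1) *v x))\<^sup>2)
      = (\<Sum>k\<in>UNIV. x \<bullet> ((conj_transpose (column_matrix X (axis k 1)) ** column_matrix X (axis k 1)) *v x))"
    by (simp add: power2_norm_eq_inner inner_matrix_vector matrix_vector_mul_assoc)
  also have "\<dots> = x \<bullet> (gram_matrix X *v x)"
    unfolding gram_matrix_eq_sum
    by (simp add: matrix_vector_mult_def vec_eq_iff inner_vec_def sum_distrib_right inner_sum_right
        sum.swap [of _ "UNIV :: 'n set"])
  also have "\<dots> \<le> norm x * (spectral_norm (gram_matrix X) * norm x)"
    by (rule order_trans [OF norm_cauchy_schwarz])
      (intro mult_left_mono norm_matrix_vector_le_spectral norm_ge_zero)
  finally show ?thesis by (simp add: power2_eq_square mult_ac)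
qed

text \<open>Bounds the spectral norm of the sum of the \<open>X j\<close> times their adjoints. The
  same matrix is the sum of the \<open>column_matrix X (axis i 1)\<close> times their
  adjoints.\<close>

definition spectral_sum :: "('p::finite \<Rightarrow> complex^'n^'m) \<Rightarrow> real" where
  "spectral_sum X = (\<Sum>j\<in>UNIV. (spectral_norm (X j))\<^sup>2)"

lemma spectral_sum_nonneg: "0 \<le> spectral_sum X"
  by (simp add: spectral_sum_def sum_nonneg)

text \<open>Component \<open>j\<close> of the \<open>i\<close>-th vector is component
  \<open>i\<close> of the adjoint of \<open>X j\<close> applied to \<open>w\<close>, so the sum
  regroups by \<open>j\<close>.\<close>

lemma sum_norm_column_matrix_adjoint_vector_le:
  fixes X :: "'p::finite \<Rightarrow> complex^'n^'m"
  shows "(\<Sum>i\<in>UNIV. (norm (conj_transpose (column_matrix X (axis i 1)) *v w))\<^sup>2) \<le> spectral_sum X * (norm w)\<^sup>2"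
proof -
  have "(conj_transpose (column_matrix X (axis i 1)) *v w) $ j = (conj_transpose (X j) *v w) $ i" for i j
    by (simp add: matrix_vector_mult_def column_matrix_axis)
  then have "(\<Sum>i\<in>UNIV. (norm (conj_transpose (column_matrix X (axis i 1)) *v w))\<^sup>2)
      = (\<Sum>j\<in>UNIV. (norm (conj_transpose (X j) *v w))\<^sup>2)"
    by (simp add: power2_norm_vec) (rule sum.swap)
  also have "\<dots> \<le> (\<Sum>j\<in>UNIV. (spectral_norm (X j) * norm w)\<^sup>2)"
    by (intro sum_mono power_mono norm_conj_transpose_vector_le) auto
  finally show ?thesis
    by (simp add: spectral_sum_def power_mult_distrib sum_distrib_right)
qed

text \<open>The inner index sits on the adjoint factor and on \<open>y\<close>, with
  \<open>L k\<close> in between. Regrouping the entries restores products of whole matrices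
  \<open>X l\<close> and \<open>X j\<close>, and Cauchy-Schwarz over \<open>l\<close>
  finishes.\<close>

lemma sum_norm_column_matrix_twisted_vector_le:
  fixes X :: "'p::finite \<Rightarrow> complex^'n^'m" and y :: "'n \<Rightarrow> complex^'p"
  defines "L \<equiv> \<lambda>i. column_matrix X (axis i 1)"
  shows "(\<Sum>k\<in>UNIV. (norm (\<Sum>i\<in>UNIV. conj_transpose (L i) *v (L k *v y i)))\<^sup>2)
    \<le> (spectral_sum X)\<^sup>2 * (\<Sum>i\<in>UNIV. (norm (y i))\<^sup>2)"
proof -
  define z where "z l = (\<chi> i. cnj (y i $ l))" for l
  let ?s = "\<lambda>j. spectral_norm (X j)"
  \<comment> \<open>Conjugation moves the adjoint from \<open>X j\<close> to \<open>X l\<close>,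
    which is why \<open>z\<close> has conjugated entries.\<close>
  have entry: "(\<Sum>i\<in>UNIV. conj_transpose (L i) *v (L k *v y i)) $ j
      = cnj ((\<Sum>l\<in>UNIV. conj_transpose (X l) *v (X j *v z l)) $ k)" for j k
  proof -
    have "(\<Sum>i\<in>UNIV. conj_transpose (L i) *v (L k *v y i)) $ j
        = (\<Sum>i\<in>UNIV. \<Sum>a\<in>UNIV. \<Sum>l\<in>UNIV. cnj (X j $ a $ i) * (X l $ a $ k * y i $ l))"
      by (simp add: matrix_vector_mult_def L_def column_matrix_axis sum_distrib_left)
    also have "\<dots> = (\<Sum>i\<in>UNIV. \<Sum>l\<in>UNIV. \<Sum>a\<in>UNIV. cnj (X j $ a $ i) * (X l $ a $ k * y i $ l))"
      by (intro sum.cong sum.swap refl)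
    also have "\<dots> = (\<Sum>l\<in>UNIV. \<Sum>i\<in>UNIV. \<Sum>a\<in>UNIV. cnj (X j $ a $ i) * (X l $ a $ k * y i $ l))"
      by (rule sum.swap)
    also have "\<dots> = (\<Sum>l\<in>UNIV. \<Sum>a\<in>UNIV. \<Sum>i\<in>UNIV. cnj (X j $ a $ i) * (X l $ a $ k * y i $ l))"
      by (intro sum.cong sum.swap refl)
    also have "\<dots> = cnj ((\<Sum>l\<in>UNIV. conj_transpose (X l) *v (X j *v z l)) $ k)"
      by (simp add: matrix_vector_mult_def z_def sum_distrib_left mult_ac)
    finally show ?thesis .
  qed
  have z: "(\<Sum>l\<in>UNIV. (norm (z l))\<^sup>2) = (\<Sum>i\<in>UNIV. (norm (y i))\<^sup>2)"
    by (simp add: power2_norm_vec z_def) (rule sum.swap)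
  have "(norm (\<Sum>l\<in>UNIV. conj_transpose (X l) *v (X j *v z l)))\<^sup>2
      \<le> (?s j)\<^sup>2 * (spectral_sum X * (\<Sum>i\<in>UNIV. (norm (y i))\<^sup>2))" for j
  proof -
    have "norm (\<Sum>l\<in>UNIV. conj_transpose (X l) *v (X j *v z l)) \<le> (\<Sum>l\<in>UNIV. ?s l * (?s j * norm (z l)))"
      by (intro sum_norm_le order_trans [OF norm_conj_transpose_vector_le] mult_left_mono
          norm_matrix_vector_le_spectral spectral_norm_nonneg)
    also have "\<dots> = ?s j * (\<Sum>l\<in>UNIV. ?s l * norm (z l))"
      by (simp add: sum_distrib_left mult_ac)
    finally have "(norm (\<Sum>l\<in>UNIV. conj_transpose (X l) *v (X j *v z l)))\<^sup>2
        \<le> (?s j * (\<Sum>l\<in>UNIV. ?s l * norm (z l)))\<^sup>2"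
      by (intro power_mono) auto
    also have "\<dots> \<le> (?s j)\<^sup>2 * (spectral_sum X * (\<Sum>l\<in>UNIV. (norm (z l))\<^sup>2))"
      unfolding power_mult_distrib spectral_sum_def
      by (intro mult_left_mono Cauchy_Schwarz_ineq_sum) auto
    finally show ?thesis unfolding z .
  qed
  then have "(\<Sum>j\<in>UNIV. (norm (\<Sum>l\<in>UNIV. conj_transpose (X l) *v (X j *v z l)))\<^sup>2)
      \<le> (\<Sum>j\<in>UNIV. (?s j)\<^sup>2 * (spectral_sum X * (\<Sum>i\<in>UNIV. (norm (y i))\<^sup>2)))"
    by (rule sum_mono)
  also have "\<dots> = (spectral_sum X)\<^sup>2 * (\<Sum>i\<in>UNIV. (norm (y i))\<^sup>2)"
    unfolding sum_distrib_right [symmetric]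
    by (simp add: power2_eq_square [of "spectral_sum X"] flip: spectral_sum_def)
  also have "(\<Sum>j\<in>UNIV. (norm (\<Sum>l\<in>UNIV. conj_transpose (X l) *v (X j *v z l)))\<^sup>2)
      = (\<Sum>k\<in>UNIV. (norm (\<Sum>i\<in>UNIV. conj_transpose (L i) *v (L k *v y i)))\<^sup>2)"
    unfolding power2_norm_vec entry complex_mod_cnj by (rule sum.swap)
  finally show ?thesis .
qed

section \<open>Bounds for the coefficient matrices and the polarised Gram form\<close>

context
  fixes X :: "'p::finite \<Rightarrow> complex^'n^'m"
begin

private abbreviation L :: "'n \<Rightarrow> complex^'p^'m" where "L i \<equiv> column_matrix X (axis i 1)"

lemma sum_norm_column_matrix_le:
  "(\<Sum>k\<in>UNIV. (norm (L k ** Y))\<^sup>2) \<le> spectral_norm (gram_matrix X) * (norm Y)\<^sup>2"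
  unfolding norm_columns column_matrix_matrix_mult sum_distrib_left
  by (subst sum.swap) (intro sum_mono sum_norm_column_matrix_vector_le)

lemma sum_norm_column_matrix_adjoint_le:
  "(\<Sum>i\<in>UNIV. (norm (conj_transpose (L i) ** W))\<^sup>2) \<le> spectral_sum X * (norm W)\<^sup>2"
  unfolding norm_columns column_matrix_matrix_mult sum_distrib_left
  by (subst sum.swap) (intro sum_mono sum_norm_column_matrix_adjoint_vector_le)

lemma sum_norm_column_matrix_twisted_le:
  "(\<Sum>k\<in>UNIV. (norm (\<Sum>i\<in>UNIV. conj_transpose (L i) ** (L k ** Y i)))\<^sup>2)
    \<le> (spectral_sum X)\<^sup>2 * (\<Sum>i\<in>UNIV. (norm (Y i))\<^sup>2)"
proof -
  have "(\<Sum>k\<in>UNIV. (norm (\<Sum>i\<in>UNIV. conj_transpose (L i) ** (L k ** Y i)))\<^sup>2)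
      = (\<Sum>b\<in>UNIV. \<Sum>k\<in>UNIV. (norm (\<Sum>i\<in>UNIV. conj_transpose (L i) *v (L k *v column b (Y i))))\<^sup>2)"
    unfolding norm_columns column_matrix_matrix_mult column_sum by (rule sum.swap)
  also have "\<dots> \<le> (\<Sum>b\<in>UNIV. (spectral_sum X)\<^sup>2 * (\<Sum>i\<in>UNIV. (norm (column b (Y i)))\<^sup>2))"
    by (intro sum_mono sum_norm_column_matrix_twisted_vector_le)
  also have "\<dots> = (spectral_sum X)\<^sup>2 * (\<Sum>i\<in>UNIV. (norm (Y i))\<^sup>2)"
    unfolding norm_columns sum_distrib_left by (rule sum.swap)
  finally show ?thesis .
qed

text \<open>Dual to \<open>sum_norm_column_matrix_adjoint_le\<close>: pairing the sum with itself
  and applying Cauchy-Schwarz yields a squared norm that cancels.\<close>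

lemma norm_sum_column_matrix_le:
  "(norm (\<Sum>i\<in>UNIV. L i ** Y i))\<^sup>2 \<le> spectral_sum X * (\<Sum>i\<in>UNIV. (norm (Y i))\<^sup>2)"
proof -
  let ?W = "\<Sum>i\<in>UNIV. L i ** Y i" and ?S = "\<Sum>i\<in>UNIV. (norm (Y i))\<^sup>2"
  have "(norm ?W)\<^sup>2 = (\<Sum>i\<in>UNIV. Y i \<bullet> (conj_transpose (L i) ** ?W))"
    by (simp add: power2_norm_eq_inner inner_sum_left inner_matrix_mult_left)
  also have "\<dots> \<le> (\<Sum>i\<in>UNIV. norm (Y i) * norm (conj_transpose (L i) ** ?W))"
    by (intro sum_mono norm_cauchy_schwarz)
  finally have "((norm ?W)\<^sup>2)\<^sup>2 \<le> (\<Sum>i\<in>UNIV. norm (Y i) * norm (conj_transpose (L i) ** ?W))\<^sup>2"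
    by (intro power_mono) auto
  also have "\<dots> \<le> ?S * (\<Sum>i\<in>UNIV. (norm (conj_transpose (L i) ** ?W))\<^sup>2)"
    by (rule Cauchy_Schwarz_ineq_sum)
  also have "\<dots> \<le> ?S * (spectral_sum X * (norm ?W)\<^sup>2)"
    by (intro mult_left_mono sum_norm_column_matrix_adjoint_le sum_nonneg) auto
  finally have le: "(norm ?W)\<^sup>2 * (norm ?W)\<^sup>2 \<le> (spectral_sum X * ?S) * (norm ?W)\<^sup>2"
    by (simp add: power2_eq_square mult_ac)
  show ?thesis
  proof (cases "?W = 0")
    case True
    then show ?thesis by (simp add: spectral_sum_nonneg sum_nonneg)
  next
    case False
    then show ?thesis by (intro mult_right_le_imp_le [OF le]) simp
  qed
qed

text \<open>Polarisation without the factor 1/2: fixing one argument at a basis vector gives the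
  partial derivative of the Gram product.\<close>

definition gram_form :: "real^'n \<Rightarrow> real^'n \<Rightarrow> complex^'p^'p" where
  "gram_form x y = conj_transpose (column_matrix X x) ** column_matrix X y
     + conj_transpose (column_matrix X y) ** column_matrix X x"

lemma bounded_bilinear_column_gram:
  "bounded_bilinear (\<lambda>x y. conj_transpose (column_matrix X x) ** column_matrix X y)"
proof -
  have l: "bounded_linear (column_matrix X)"
    using linear_column_matrix by (simp add: linear_conv_bounded_linear)
  show ?thesis
    by (rule bounded_bilinear.comp [OF bounded_bilinear_matrix_mult
          bounded_linear_compose [OF bounded_linear_conj_transpose l] l])
qed

lemma bounded_bilinear_gram_form: "bounded_bilinear gram_form"
proof -
  interpret T: bounded_bilinear "\<lambda>x y. conj_transpose (column_matrix X x) ** column_matrix X y"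
    by (rule bounded_bilinear_column_gram)
  have "bilinear gram_form"
    unfolding bilinear_def gram_form_def
    by (auto intro!: linearI simp: T.add_left T.add_right T.scaleR_left T.scaleR_right scaleR_right_distrib)
  then show ?thesis by (simp add: bilinear_conv_bounded_bilinear)
qed

lemma gram_form_commute: "gram_form x y = gram_form y x"
  by (simp add: gram_form_def add.commute)

lemma hermitian_gram_form: "hermitian (gram_form x y)"
  unfolding hermitian_def gram_form_def
    linear_add [OF bounded_linear.linear [OF bounded_linear_conj_transpose]] conj_transpose_mult
  by (simp add: add.commute)

text \<open>Supplies \<open>v1\<close>. The two orders of multiplication give equal sums after
  exchanging indices, and the square of a sum costs a factor 2 for each.\<close>

lemma gram_form_row_bound:
  "(\<Sum>k\<in>UNIV. \<Sum>i\<in>UNIV. (norm (gram_form (axis i 1) (axis k 1) ** Y))\<^sup>2)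
    \<le> 4 * spectral_sum X * spectral_norm (gram_matrix X) * (norm Y)\<^sup>2"
proof -
  let ?a = "\<lambda>i k. (norm (conj_transpose (L i) ** (L k ** Y)))\<^sup>2"
  have "(norm (gram_form (axis i 1) (axis k 1) ** Y))\<^sup>2 \<le> 2 * ?a i k + 2 * ?a k i" for i k
    unfolding gram_form_def matrix_mult_add_left matrix_mul_assoc [symmetric] by (rule norm_add_power2_le)
  then have "(\<Sum>k\<in>UNIV. \<Sum>i\<in>UNIV. (norm (gram_form (axis i 1) (axis k 1) ** Y))\<^sup>2)
      \<le> (\<Sum>k\<in>UNIV. \<Sum>i\<in>UNIV. 2 * ?a i k + 2 * ?a k i)"
    by (intro sum_mono)
  also have "\<dots> = 2 * (\<Sum>k\<in>UNIV. \<Sum>i\<in>UNIV. ?a i k) + 2 * (\<Sum>k\<in>UNIV. \<Sum>i\<in>UNIV. ?a k i)"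
    by (simp only: sum.distrib sum_distrib_left)
  also have "(\<Sum>k\<in>UNIV. \<Sum>i\<in>UNIV. ?a k i) = (\<Sum>k\<in>UNIV. \<Sum>i\<in>UNIV. ?a i k)"
    by (rule sum.swap)
  also have "(\<Sum>k\<in>UNIV. \<Sum>i\<in>UNIV. ?a i k) \<le> (\<Sum>k\<in>UNIV. spectral_sum X * (norm (L k ** Y))\<^sup>2)"
    by (intro sum_mono sum_norm_column_matrix_adjoint_le)
  also have "\<dots> \<le> spectral_sum X * (spectral_norm (gram_matrix X) * (norm Y)\<^sup>2)"
    unfolding sum_distrib_left [symmetric]
    by (intro mult_left_mono sum_norm_column_matrix_le spectral_sum_nonneg)
  finally show ?thesis by (simp add: mult.assoc)
qed

text \<open>Supplies \<open>v2\<close>. One half of the form gives the twisted sum; in the other the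
  adjoint of \<open>L k\<close> factors out, leaving \<open>?W\<close>.\<close>

lemma gram_form_column_bound:
  "(\<Sum>k\<in>UNIV. (norm (\<Sum>i\<in>UNIV. gram_form (axis i 1) (axis k 1) ** Y i))\<^sup>2)
    \<le> 4 * (spectral_sum X)\<^sup>2 * (\<Sum>i\<in>UNIV. (norm (Y i))\<^sup>2)"
proof -
  let ?S = "\<Sum>i\<in>UNIV. (norm (Y i))\<^sup>2" and ?W = "\<Sum>i\<in>UNIV. L i ** Y i"
  let ?a = "\<lambda>k. (norm (\<Sum>i\<in>UNIV. conj_transpose (L i) ** (L k ** Y i)))\<^sup>2"
    and ?b = "\<lambda>k. (norm (conj_transpose (L k) ** ?W))\<^sup>2"
  have "(norm (\<Sum>i\<in>UNIV. gram_form (axis i 1) (axis k 1) ** Y i))\<^sup>2 \<le> 2 * ?a k + 2 * ?b k" for k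
    unfolding gram_form_def matrix_mult_add_left matrix_mul_assoc [symmetric] sum.distrib matrix_mult_sum_right
    by (rule norm_add_power2_le)
  then have "(\<Sum>k\<in>UNIV. (norm (\<Sum>i\<in>UNIV. gram_form (axis i 1) (axis k 1) ** Y i))\<^sup>2)
      \<le> (\<Sum>k\<in>UNIV. 2 * ?a k + 2 * ?b k)"
    by (rule sum_mono)
  also have "\<dots> = 2 * (\<Sum>k\<in>UNIV. ?a k) + 2 * (\<Sum>k\<in>UNIV. ?b k)"
    by (simp only: sum.distrib sum_distrib_left)
  also have "(\<Sum>k\<in>UNIV. ?a k) \<le> (spectral_sum X)\<^sup>2 * ?S"
    by (rule sum_norm_column_matrix_twisted_le)
  also have "(\<Sum>k\<in>UNIV. ?b k) \<le> spectral_sum X * (norm ?W)\<^sup>2"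
    by (rule sum_norm_column_matrix_adjoint_le)
  also have "(norm ?W)\<^sup>2 \<le> spectral_sum X * ?S"
    by (rule norm_sum_column_matrix_le)
  finally show ?thesis
    by (simp add: mult_left_mono spectral_sum_nonneg power2_eq_square)
qed

end

section \<open>The tail bound\<close>

lemma gram_form_self:
  "(1/2) *\<^sub>R gram_form X x x = conj_transpose (column_matrix X x) ** column_matrix X x"
  by (simp add: gram_form_def flip: scaleR_2)

context gaussian_vector
begin

lemma integrable_polynomial_vector:
  fixes f :: "real^'n \<Rightarrow> 'b::euclidean_space"
  assumes "polynomial_function f"
  shows "integrable P (\<lambda>w. f (u w))"
proof -
  have "integrable P (\<lambda>w. \<Sum>b\<in>Basis. (f (u w) \<bullet> b) *\<^sub>R b)"
    using integrable_inner_polynomial [OF assms polynomial_function_const]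
    by (intro Bochner_Integration.integrable_sum integrable_scaleR_left) auto
  then show ?thesis by (simp add: euclidean_representation)
qed

text \<open>Expanding one argument gives coordinates times linear functions, and integration by
  parts replaces each product by a constant derivative.\<close>

lemma expectation_quadratic_form:
  fixes T :: "real^'n \<Rightarrow> real^'n \<Rightarrow> 'b::euclidean_space"
  assumes "bounded_bilinear T"
  shows "expectation (\<lambda>w. T (u w) (u w)) = (\<Sum>k\<in>UNIV. T (axis k 1) (axis k 1))"
proof (rule euclidean_eqI)
  fix b :: 'b
  interpret T: bounded_bilinear T by fact
  let ?e = "\<lambda>k. axis k 1 :: real^'n"
  have polyT: "polynomial_function (\<lambda>x. T x x)"
    by (rule polynomial_function_bilinear [OF assms polynomial_function_id polynomial_function_id])
  have bl: "bounded_linear (\<lambda>y. T (?e k) y \<bullet> b)" for k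
    by (rule bounded_linear_compose [OF bounded_linear_inner_left T.bounded_linear_right])
  have polyf: "real_polynomial_function (\<lambda>x. T (?e k) x \<bullet> b)" for k
    by (rule real_polynomial_function.intros(1) [OF bl])
  have line: "((\<lambda>t. x + t *\<^sub>R ?e k) has_vector_derivative ?e k) (at 0)" for x k
    by (auto intro!: derivative_eq_intros)
  have deriv: "((\<lambda>t. T (?e k) (x + t *\<^sub>R ?e k) \<bullet> b) has_vector_derivative T (?e k) (?e k) \<bullet> b) (at 0)" for x k
    by (rule bounded_linear.has_vector_derivative [OF bl line])
  have expand: "T x x \<bullet> b = (\<Sum>k\<in>UNIV. x $ k * (T (?e k) x \<bullet> b))" for x
  proof -
    have "T x x = T (\<Sum>k\<in>UNIV. x $ k *\<^sub>R ?e k) x"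
      using basis_expansion [of x] by (simp add: scalar_mult_eq_scaleR)
    then show ?thesis by (simp add: T.sum_left T.scaleR_left inner_sum_left)
  qed
  have int: "integrable P (\<lambda>w. u w $ k * (T (?e k) (u w) \<bullet> b))" for k
    using integrable_polynomial [OF real_polynomial_function.intros(4)
        [OF real_polynomial_function.intros(1) [OF bounded_linear_vec_nth] polyf]] .
  have "expectation (\<lambda>w. T (u w) (u w)) \<bullet> b = expectation (\<lambda>w. T (u w) (u w) \<bullet> b)"
    using integrable_polynomial_vector [OF polyT] by (simp add: integral_inner_left)
  also have "\<dots> = (\<Sum>k\<in>UNIV. expectation (\<lambda>w. u w $ k * (T (?e k) (u w) \<bullet> b)))"
    unfolding expand using int by (intro Bochner_Integration.integral_sum) auto
  also have "\<dots> = (\<Sum>k\<in>UNIV. T (?e k) (?e k)) \<bullet> b"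
    using gaussian_integration_by_parts(2) [OF polyf deriv] by (simp add: prob_space inner_sum_left)
  finally show "expectation (\<lambda>w. T (u w) (u w)) \<bullet> b = (\<Sum>k\<in>UNIV. T (?e k) (?e k)) \<bullet> b" .
qed

lemma expectation_column_gram:
  fixes X :: "'p::finite \<Rightarrow> complex^'n^'m"
  shows "expectation (\<lambda>w. conj_transpose (column_matrix X (u w)) ** column_matrix X (u w)) = gram_matrix X"
  unfolding gram_matrix_eq_sum
  by (rule expectation_quadratic_form [OF bounded_bilinear_column_gram])

text \<open>Markov's inequality for the moment of order \<open>2 * q\<close> at a nearly optimal
  \<open>q\<close>. The 2 in the exponent pays for rounding to an integer.\<close>

lemma gram_deviation_tail:
  fixes X :: "'p::finite \<Rightarrow> complex^'n^'m" and \<sigma> s :: real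
  defines "N \<equiv> gram_matrix X"
  defines "Z \<equiv> \<lambda>x. conj_transpose (column_matrix X x) ** column_matrix X x - N"
  assumes \<sigma>: "0 < \<sigma>" "\<sigma>\<^sup>2 \<le> 3" and sum_le: "spectral_sum X \<le> \<sigma>\<^sup>2 * spectral_norm N"
    and N: "0 < spectral_norm N" and s: "0 < s"
  shows "measure P {\<omega> \<in> space P. s * spectral_norm N \<le> spectral_norm (Z (u \<omega>))}
    \<le> 4 * real CARD('p) * exp (2 - s / (exp 1 * sqrt 2 * \<sigma>))"
proof -
  let ?\<nu> = "spectral_norm N" and ?\<tau> = "spectral_sum X" and ?H = "gram_form X"
  let ?E = "{\<omega> \<in> space P. s * ?\<nu> \<le> spectral_norm (Z (u \<omega>))}"
  \<comment> \<open>The real minimiser in q of (2 sqrt 2 \<sigma> q / s)^(2q), with minimum value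
    \<open>exp (- 2 * y)\<close>.\<close>
  define y where "y = s / (2 * sqrt 2 * \<sigma> * exp 1)"
  define q where "q = nat \<lfloor>y\<rfloor>"
  have y: "0 < y" using s \<sigma> by (simp add: y_def)
  have y2: "2 * y = s / (exp 1 * sqrt 2 * \<sigma>)" by (simp add: y_def field_simps)
  have s_eq: "s = exp 1 * y * (2 * sqrt 2 * \<sigma>)" using \<sigma> by (simp add: y_def)
  have qy: "real q \<le> y" "y < real q + 1" using y unfolding q_def by linarith+
  have card: "1 \<le> real CARD('p)" by (simp add: Suc_leI)
  have Z_eq: "Z x = (1/2) *\<^sub>R (?H x x - (\<Sum>k\<in>UNIV. ?H (axis k 1) (axis k 1)))" for x
    unfolding Z_def N_def gram_matrix_eq_sum gram_form_self [symmetric]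
    by (simp only: scaleR_diff_right scaleR_sum_right)
  show ?thesis
  proof (cases "q = 0")
    \<comment> \<open>Here \<open>y < 1\<close>, so the claimed bound is at least 1.\<close>
    case True
    have "measure P ?E \<le> 1" by (rule prob_le_1)
    also have "1 \<le> 4 * real CARD('p) * exp (2 - 2 * y)"
    proof -
      have "1 \<le> 4 * real CARD('p)" using card by linarith
      moreover have "1 \<le> exp (2 - 2 * y)" using qy True by simp
      ultimately have "1 * 1 \<le> 4 * real CARD('p) * exp (2 - 2 * y)"
        by (rule mult_mono) simp_all
      then show ?thesis by simp
    qed
    finally show ?thesis unfolding y2 .
  next
    case False
    let ?f = "\<lambda>\<omega>. (norm (mpow (Z (u \<omega>)) q))\<^sup>2"
    have polyZ: "polynomial_function Z"
      unfolding Z_eq [abs_def]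
      by (intro polynomial_function_cmul polynomial_function_diff
          polynomial_function_bilinear [OF bounded_bilinear_gram_form] polynomial_function_id polynomial_function_const)
    then have int: "integrable P ?f"
      by (intro integrable_norm_polynomial polynomial_function_mpow)
    have hermZ: "hermitian (Z x)" for x
    proof -
      have "conj_transpose (A - B) = conj_transpose A - conj_transpose B" for A B :: "complex^'p^'p"
        by (simp add: vec_eq_iff)
      moreover have "conj_transpose N = N"
        unfolding N_def gram_matrix_def by (simp add: vec_eq_iff frobenius_inner_def trace_def
            matrix_matrix_mult_def mult.commute)
      ultimately show ?thesis by (simp add: hermitian_def Z_def conj_transpose_mult)
    qed
    have "(s * ?\<nu>) ^ (2 * q) \<le> ?f \<omega>" if "s * ?\<nu> \<le> spectral_norm (Z (u \<omega>))" for \<omega>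
    proof -
      have "(s * ?\<nu>) ^ q \<le> spectral_norm (Z (u \<omega>)) ^ q"
        using that s N by (intro power_mono) auto
      also have "\<dots> \<le> norm (mpow (Z (u \<omega>)) q)"
        using False by (intro spectral_norm_power_le hermZ) simp
      finally have "((s * ?\<nu>) ^ q)\<^sup>2 \<le> ?f \<omega>"
        using s N by (intro power_mono) auto
      then show ?thesis by (simp add: mult.commute flip: power_mult)
    qed
    then have "measure P ?E \<le> measure P {\<omega> \<in> space P. (s * ?\<nu>) ^ (2 * q) \<le> ?f \<omega>}"
      using int by (intro finite_measure_mono) auto
    also have "\<dots> \<le> expectation ?f / (s * ?\<nu>) ^ (2 * q)"
      using int s N by (intro integral_Markov_inequality_measure [where A = "space P"]) auto
    also have "\<dots> \<le> 4 * real CARD('p) * exp (- (2 * real q))"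
    proof -
      \<comment> \<open>The average of the two variance bounds. Since \<sigma>^2 \<le> 3 gives
        \<open>?\<nu> + ?\<tau> \<le> 4 * ?\<nu>\<close>, it is at most 8 \<sigma>^2
        \<open>?\<nu>\<close>^2; the 8 is the square of the 2 sqrt 2 in \<open>y\<close>.\<close>
      let ?\<alpha> = "(4 * ?\<tau> * ?\<nu> + 4 * ?\<tau>\<^sup>2) / 2"
      have "?\<alpha> = 2 * ?\<tau> * (?\<nu> + ?\<tau>)"
        by (simp add: power2_eq_square algebra_simps)
      also have "\<dots> \<le> 2 * (\<sigma>\<^sup>2 * ?\<nu>) * (?\<nu> + 3 * ?\<nu>)"
      proof -
        have "\<sigma>\<^sup>2 * ?\<nu> \<le> 3 * ?\<nu>" using \<sigma> N by (intro mult_right_mono) auto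
        with sum_le have "?\<tau> \<le> 3 * ?\<nu>" by linarith
        then show ?thesis
          using sum_le spectral_sum_nonneg [of X] N by (intro mult_mono) auto
      qed
      also have "\<dots> = 8 * \<sigma>\<^sup>2 * ?\<nu>\<^sup>2" by (simp add: power2_eq_square)
      finally have \<alpha>: "?\<alpha> \<le> 8 * \<sigma>\<^sup>2 * ?\<nu>\<^sup>2" .
      have "expectation ?f \<le> 4 * real CARD('p) * ((real q)\<^sup>2 * ?\<alpha>) ^ q"
        unfolding Z_eq
        by (rule hermitian_chaos_moment [OF bounded_bilinear_gram_form [of X] gram_form_commute
              hermitian_gram_form gram_form_row_bound [where X = X, folded N_def] gram_form_column_bound])
          (use False N spectral_sum_nonneg [of X] in auto)
      also have "\<dots> \<le> 4 * real CARD('p) * (y\<^sup>2 * (8 * \<sigma>\<^sup>2 * ?\<nu>\<^sup>2)) ^ q"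
        using \<alpha> qy N spectral_sum_nonneg [of X]
        by (intro mult_left_mono power_mono mult_mono) auto
      also have "y\<^sup>2 * (8 * \<sigma>\<^sup>2 * ?\<nu>\<^sup>2) = (s * ?\<nu>)\<^sup>2 * (exp (- 1))\<^sup>2"
        by (simp add: s_eq power_mult_distrib exp_minus field_simps)
      also have "\<dots> ^ q = (s * ?\<nu>) ^ (2 * q) * exp (- (2 * real q))"
        by (simp add: power_mult_distrib exp_of_nat_mult [symmetric] flip: power_mult)
      finally show ?thesis
        using s N by (simp add: pos_divide_le_eq mult_ac)
    qed
    also have "\<dots> \<le> 4 * real CARD('p) * exp (2 - 2 * y)"
      using qy by (intro mult_left_mono) auto
    finally show ?thesis unfolding y2 .
  qed
qed

end

section \<open>From condition numbers to the parameters of the tail bound\<close>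

lemma rank_eq_0_imp: "rank A = 0 \<Longrightarrow> A = 0" for A :: "complex^'n^'m"
proof -
  assume "rank A = 0"
  then have "rows A \<subseteq> {0}"
    by (simp add: row_rank_def_gen vec.dim_eq_0)
  then have "row i A = 0" for i by (auto simp: rows_def)
  then show "A = 0" by (simp add: row_def vec_eq_iff)
qed

lemma spectral_norm_mult_inverse_ge_1:
  fixes A :: "complex^'p^'p"
  assumes "invertible A"
  shows "1 \<le> spectral_norm A * spectral_norm (matrix_inv A)"
proof -
  define x where "x = (axis undefined 1 :: complex^'p)"
  have "A ** matrix_inv A = mat 1"
    using assms someI_ex [of "\<lambda>A'. A ** A' = mat 1 \<and> A' ** A = mat 1"]
    by (simp add: invertible_def matrix_inv_def)
  then have "norm x = norm (A *v (matrix_inv A *v x))"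
    by (simp add: matrix_vector_mul_assoc)
  also have "\<dots> \<le> spectral_norm A * (spectral_norm (matrix_inv A) * norm x)"
    by (rule order_trans [OF norm_matrix_vector_le_spectral])
      (intro mult_left_mono norm_matrix_vector_le_spectral spectral_norm_nonneg)
  finally show ?thesis by (simp add: x_def)
qed

lemma spectral_norm_pos: "A \<noteq> 0 \<Longrightarrow> 0 < spectral_norm A" for A :: "complex^'n^'m"
  unfolding spectral_norm_def
  by (subst onorm_pos_lt [OF bounded_linear_matrix_vector_mult])
    (metis matrix_eq matrix_vector_mult_0)

text \<open>The squared Frobenius norms are the diagonal entries of the Gram matrix.\<close>

lemma frobenius_norm_le_gram:
  fixes X :: "'p::finite \<Rightarrow> complex^'n^'m"
  shows "(frobenius_norm (X j))\<^sup>2 \<le> spectral_norm (gram_matrix X)"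
proof -
  have "(gram_matrix X *v axis j 1) $ j = gram_matrix X $ j $ j"
    by (simp add: matrix_vector_mult_def axis_def if_distrib [of "\<lambda>x. _ * x"] cong: if_cong)
  also have "\<dots> = complex_of_real ((frobenius_norm (X j))\<^sup>2)"
    by (simp add: gram_matrix_def frobenius_inner_self)
  finally have "(frobenius_norm (X j))\<^sup>2 = cmod ((gram_matrix X *v axis j 1) $ j)"
    by (simp only: norm_of_real abs_power2)
  also have "\<dots> \<le> spectral_norm (gram_matrix X) * norm (axis j 1 :: complex^'p)"
    by (rule order_trans [OF Finite_Cartesian_Product.norm_nth_le norm_matrix_vector_le_spectral])
  finally show ?thesis by simp
qed

text \<open>The weak condition number controls each spectral norm by the Frobenius norm, which the
  Gram matrix controls in turn.\<close>

lemma spectral_sum_le: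
  fixes X :: "'p::finite \<Rightarrow> complex^'n^'m"
  assumes "\<And>j. X j \<noteq> 0"
  shows "spectral_sum X \<le> real CARD('p) * ((family_weak_condition X)\<^sup>2 / real CARD('n)) * spectral_norm (gram_matrix X)"
proof -
  let ?w = "family_weak_condition X"
  have "(spectral_norm (X j))\<^sup>2 \<le> ?w\<^sup>2 / real CARD('n) * spectral_norm (gram_matrix X)" for j
  proof -
    have F: "0 < frobenius_norm (X j)" using assms [of j] by (simp add: frobenius_norm_eq_norm)
    have "weak_condition (X j) \<le> ?w"
      unfolding family_weak_condition_def by (intro Max_ge) auto
    then have "spectral_norm (X j) * sqrt (real CARD('n)) \<le> ?w * frobenius_norm (X j)"
      using F by (simp add: weak_condition_def divide_le_eq)
    then have "(spectral_norm (X j) * sqrt (real CARD('n)))\<^sup>2 \<le> (?w * frobenius_norm (X j))\<^sup>2"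
      by (intro power_mono) (auto simp: spectral_norm_nonneg)
    then have "(spectral_norm (X j))\<^sup>2 \<le> ?w\<^sup>2 / real CARD('n) * (frobenius_norm (X j))\<^sup>2"
      by (simp add: power_mult_distrib field_simps)
    also have "\<dots> \<le> ?w\<^sup>2 / real CARD('n) * spectral_norm (gram_matrix X)"
      by (intro mult_left_mono frobenius_norm_le_gram) auto
    finally show ?thesis .
  qed
  then have "spectral_sum X \<le> (\<Sum>j\<in>(UNIV :: 'p set). ?w\<^sup>2 / real CARD('n) * spectral_norm (gram_matrix X))"
    unfolding spectral_sum_def by (rule sum_mono)
  then show ?thesis by simp
qed

lemma family_weak_condition_pos:
  assumes "\<And>j. X j \<noteq> 0"
  shows "0 < family_weak_condition X"
proof -
  have "0 < weak_condition (X j)" for j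
    using assms [of j] spectral_norm_pos [of "X j"]
    by (simp add: weak_condition_def frobenius_norm_eq_norm)
  then show ?thesis
    unfolding family_weak_condition_def by (subst Max_gr_iff) auto
qed

theorem corollary1p6:
  fixes A :: "complex^'n^'m"
    and B :: "'p::finite \<Rightarrow> complex^'m^'n"
    and P :: "'w measure"
    and u :: "'w \<Rightarrow> real^'n"
    and C t :: real
  defines "BA \<equiv> (\<lambda>j. B j ** A)"
  defines "r \<equiv> real (rank A)"
  defines "L \<equiv> (\<lambda>\<omega>. column_matrix BA (u \<omega>))"
  defines "M \<equiv> (\<lambda>\<omega>. conj_transpose (L \<omega>) ** L \<omega>)"
  defines "N \<equiv> prob_space.expectation P M"
  defines "\<kappa> \<equiv> family_condition BA"
  defines "lam \<equiv> sqrt (r / real CARD('n)) * family_weak_condition BA"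
  defines "C\<^sub>1 \<equiv> sqrt 2"
  defines "C\<^sub>2 \<equiv> 2 ^ 14"
  defines "\<alpha> \<equiv> t * C / (exp 1 * C\<^sub>1)"
  assumes "prob_space P"
    and "std_gaussian_vector P u"
    and "\<And>j. BA j \<noteq> 0"
    and "C \<ge> 1"
    and "ereal r \<ge> ereal (real CARD('p)) * (ereal C * \<kappa> * ereal lam * ereal (ln r)) ^ 2"
    and "t > 0"
  shows "measure P {\<omega> \<in> space P. ereal (spectral_norm (M \<omega> - N)) \<ge> ereal (t * spectral_norm N) / \<kappa>}
           \<le> 2 * C\<^sub>2 * real CARD('p) * r powr (1 - \<alpha>)"
proof -
  interpret gaussian_vector P u
    using assms(11,12) by (simp add: gaussian_vector_def gaussian_vector_axioms_def)
  let ?p = "real CARD('p)" and ?w = "family_weak_condition BA" and ?\<nu> = "spectral_norm (gram_matrix BA)"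
  let ?E = "{\<omega> \<in> space P. ereal (spectral_norm (M \<omega> - N)) \<ge> ereal (t * spectral_norm N) / \<kappa>}"
  have N: "N = gram_matrix BA"
    unfolding N_def M_def L_def by (rule expectation_column_gram)
  have p: "1 \<le> ?p" by (simp add: Suc_leI)
  \<comment> \<open>Rank zero would make every \<open>BA j\<close> vanish.\<close>
  have "rank A \<noteq> 0"
  proof
    assume "rank A = 0"
    then have "BA undefined = 0"
      using rank_eq_0_imp [of A] by (simp add: BA_def matrix_mult_zero_right)
    with assms(13) show False by blast
  qed
  then consider "r = 1" | "2 \<le> r" by (force simp: r_def)
  then show ?thesis
  proof cases
    \<comment> \<open>At rank 1 the power is 1 and the bound exceeds every probability.\<close>
    case 1
    have "measure P ?E \<le> 1 * 1" by simp
    also have "1 * 1 \<le> 2 * C\<^sub>2 * ?p"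
      using p by (intro mult_mono) (simp_all add: C\<^sub>2_def)
    finally show ?thesis unfolding 1 by simp
  next
    case 2
    have "ln 2 \<le> ln r" using 2 by simp
    then have ln: "2/3 \<le> ln r" using ln2_ge_two_thirds by linarith
    have w: "0 < ?w" by (rule family_weak_condition_pos [OF assms(13)])
    have lam: "0 < lam" using w 2 by (simp add: lam_def)
    \<comment> \<open>A singular Gram matrix makes \<kappa> infinite. The other factors are
      positive, with \<open>ln r > 0\<close> from rank at least 2, so the size hypothesis would
      fail.\<close>
    have inv: "invertible (gram_matrix BA)"
    proof (rule ccontr)
      assume "\<not> invertible (gram_matrix BA)"
      then have "\<kappa> = \<infinity>" by (simp add: \<kappa>_def family_condition_def condition_number_def)
      then show False
        using assms(15) \<open>C \<ge> 1\<close> lam ln p by (simp add: power2_eq_square)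
    qed
    define k where "k = ?\<nu> * spectral_norm (matrix_inv (gram_matrix BA))"
    have \<kappa>: "\<kappa> = ereal k"
      using inv by (simp add: \<kappa>_def family_condition_def condition_number_def k_def)
    have k: "1 \<le> k"
      unfolding k_def by (rule spectral_norm_mult_inverse_ge_1 [OF inv])
    have \<nu>: "0 < ?\<nu>"
      using k spectral_norm_nonneg [of "gram_matrix BA"] unfolding k_def by (cases "?\<nu> = 0") auto
    \<comment> \<open>With this choice the size hypothesis becomes \<open>main\<close>, and the rank
      cancels in \<sigma>^2, leaving the factor of \<open>spectral_sum_le\<close>.\<close>
    define \<sigma> where "\<sigma> = lam * sqrt (?p / r)"
    have \<sigma>: "0 < \<sigma>" using lam p 2 by (simp add: \<sigma>_def)
    have "?p * (C * k * lam * ln r)\<^sup>2 \<le> r"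
      using assms(15) by (simp add: \<kappa>)
    then have "(C * k * \<sigma> * ln r)\<^sup>2 \<le> 1\<^sup>2"
      using 2 p by (simp add: \<sigma>_def power_mult_distrib field_simps)
    then have main: "C * k * \<sigma> * ln r \<le> 1"
      by (rule power2_le_imp_le) simp
    \<comment> \<open>As \<open>C\<close> and \<open>k\<close> are at least 1 and
      \<open>ln r\<close> at least 2/3, \<open>main\<close> forces \<sigma> \<le> 3/2, hence
      \<sigma>^2 \<le> 9/4, within the 3 that the tail bound allows.\<close>
    have "\<sigma> * (2/3) \<le> C * k * \<sigma> * ln r"
    proof -
      have "1 * 1 \<le> C * k" using k \<open>C \<ge> 1\<close> by (intro mult_mono) auto
      then have "1 * \<sigma> * (2/3) \<le> C * k * \<sigma> * ln r"
        using ln \<sigma> by (intro mult_mono) auto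
      then show ?thesis by simp
    qed
    with main have "\<sigma> \<le> 3/2" by linarith
    then have "\<sigma>\<^sup>2 \<le> (3/2)\<^sup>2" using \<sigma> by (intro power_mono) auto
    then have \<sigma>2: "\<sigma>\<^sup>2 \<le> 3" by (simp add: power2_eq_square)
    have "\<sigma>\<^sup>2 = ?p * (?w\<^sup>2 / real CARD('n))"
      using 2 by (simp add: \<sigma>_def lam_def power_mult_distrib)
    then have sum_le: "spectral_sum BA \<le> \<sigma>\<^sup>2 * ?\<nu>"
      using spectral_sum_le [OF assms(13)] by simp
    have "?E = {\<omega> \<in> space P. t / k * ?\<nu> \<le> spectral_norm (conj_transpose (column_matrix BA (u \<omega>)) ** column_matrix BA (u \<omega>) - gram_matrix BA)}"
      using k by (simp add: \<kappa> N M_def L_def)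
    then have "measure P ?E \<le> 4 * ?p * exp (2 - t / k / (exp 1 * sqrt 2 * \<sigma>))"
      using gram_deviation_tail [OF \<sigma> \<sigma>2 sum_le \<nu>, of "t / k"] \<open>t > 0\<close> k by simp
    \<comment> \<open>By \<open>main\<close>, 1 / (k \<sigma>) is at least \<open>C * ln r\<close>,
      which turns the exponent of the tail into \<alpha> ln r.\<close>
    also have "\<dots> \<le> 4 * ?p * exp (2 - \<alpha> * ln r)"
    proof -
      have "C * ln r \<le> 1 / (k * \<sigma>)"
        using main k \<sigma> by (simp add: field_simps)
      then have "t / (exp 1 * sqrt 2) * (C * ln r) \<le> t / (exp 1 * sqrt 2) * (1 / (k * \<sigma>))"
        using \<open>t > 0\<close> by (intro mult_left_mono) auto
      then have "\<alpha> * ln r \<le> t / k / (exp 1 * sqrt 2 * \<sigma>)"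
        by (simp add: \<alpha>_def C\<^sub>1_def mult_ac)
      then show ?thesis by (intro mult_left_mono) auto
    qed
    also have "\<dots> = 4 * ?p * (exp 1)\<^sup>2 * r powr (- \<alpha>)"
      using 2 by (simp add: powr_def exp_diff exp_minus divide_inverse flip: exp_double)
    also have "\<dots> \<le> 4 * ?p * 3\<^sup>2 * r powr (- \<alpha>)"
      using exp_le p by (intro mult_right_mono mult_left_mono power_mono) auto
    \<comment> \<open>The accumulated constant 36 lies far below 2^15, and the additional factor
      \<open>r\<close> is at least 1.\<close>
    also have "\<dots> \<le> 2 * C\<^sub>2 * ?p * (r * r powr (- \<alpha>))"
    proof -
      have "4 * ?p * 3\<^sup>2 * r powr (- \<alpha>) = 36 * ?p * (1 * r powr (- \<alpha>))" by simp
      also have "\<dots> \<le> 2 * C\<^sub>2 * ?p * (r * r powr (- \<alpha>))"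
        using 2 p by (intro mult_mono) (auto simp: C\<^sub>2_def)
      finally show ?thesis .
    qed
    also have "r * r powr (- \<alpha>) = r powr (1 - \<alpha>)"
      using 2 by (simp add: powr_diff powr_minus_divide)
    finally show ?thesis .
  qed
qed

end
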